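(* Let $D=(V+r,E)$ be a finite acyclic directed graph with root node $r\notin V$ and let $w:E\to\mathbb{Q}_+$ be a weight function. Then a maximal flame $F\subseteq E$ in $D$ of minimum total weight $\sum_{e\in F}w(e)$ can be found in $O(|E|^2)$ time.
   Context: For a directed graph $H$ with root $r$ and vertex $v\neq r$, $\lambda_H(r,v)$ denotes the maximum number of pairwise edge-disjoint directed paths from $r$ to $v$ in $H$, and $\varrho_H(v)$ the in-degree of $v$ in $H$. Spanning subgraphs are identified with their edge sets. A maximal flame in $D=(V+r,E)$ is an edge set $F\subseteq E$ such that the spanning subgraph $(V+r,F)$ satisfies $\lambda_D(r,v)=\lambda_F(r,v)=\varrho_F(v)$ for every $v\in V$. *)

theory Defs
  imports "Graph_Theory.Graph_Theory" "HOL-Library.Landau_Symbols"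
begin

section \<open>Maximal flames\<close>

text \<open>Digraphs are those of Graph_Theory, so parallel arcs are allowed. A cycle may be a loop.\<close>

definition acyclic_digraph :: "('a, 'b) pre_digraph \<Rightarrow> bool" where
  "acyclic_digraph D \<longleftrightarrow> (\<nexists>p. pre_digraph.cycle D p)"

definition arc_disjoint_paths ::
    "('a, 'b) pre_digraph \<Rightarrow> 'a \<Rightarrow> 'a \<Rightarrow> 'b list set \<Rightarrow> bool" where
  "arc_disjoint_paths H r v P \<longleftrightarrow>
     (\<forall>p\<in>P. pre_digraph.apath H r p v) \<and> pairwise (\<lambda>p q. set p \<inter> set q = {}) P"

text \<open>The maximum is meaningful for finite digraphs only, where there are finitely many paths.\<close>

definition arc_conn :: "('a, 'b) pre_digraph \<Rightarrow> 'a \<Rightarrow> 'a \<Rightarrow> nat" where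
  "arc_conn H r v = Max {card P | P. arc_disjoint_paths H r v P}"

abbreviation spanning_subgraph :: "('a, 'b) pre_digraph \<Rightarrow> 'b set \<Rightarrow> ('a, 'b) pre_digraph" where
  "spanning_subgraph D F \<equiv> D\<lparr>arcs := F\<rparr>"

definition maximal_flame :: "('a, 'b) pre_digraph \<Rightarrow> 'a \<Rightarrow> 'b set \<Rightarrow> bool" where
  "maximal_flame D r F \<longleftrightarrow> F \<subseteq> arcs D \<and>
     (\<forall>v \<in> verts D - {r}.
        arc_conn D r v = arc_conn (spanning_subgraph D F) r v \<and>
        arc_conn (spanning_subgraph D F) r v = in_degree (spanning_subgraph D F) v)"

definition min_weight_maximal_flame ::
    "('a, 'b) pre_digraph \<Rightarrow> 'a \<Rightarrow> ('b \<Rightarrow> rat) \<Rightarrow> 'b set \<Rightarrow> bool" where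
  "min_weight_maximal_flame D r w F \<longleftrightarrow> maximal_flame D r F \<and>
     (\<forall>F'. maximal_flame D r F' \<longrightarrow> (\<Sum>e\<in>F. w e) \<le> (\<Sum>e\<in>F'. w e))"


section \<open>Random access machine\<close>

text \<open>
  The machine has registers and arrays of natural numbers, both named by natural numbers (a program
  mentions only finitely many names), and a read-only array of rational weights. Weights can only
  be compared with each other. The only arithmetic on natural numbers is increment and (truncated)
  decrement, so that after t steps no number exceeds t plus the largest number in the input or in
  the program; the unit-cost measure is therefore not abused by computing with huge numbers.
\<close>

record state =
  reg :: "nat \<Rightarrow> nat"
  mem :: "nat \<Rightarrow> nat \<Rightarrow> nat"
  wt :: "nat \<Rightarrow> rat"

datatype test =
    Eq nat nat
  | Less nat nat
  | WLess nat nat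

datatype com =
    SKIP
  | Const nat nat
  | Copy nat nat
  | Inc nat
  | Dec nat
  | Load nat nat nat
  | Store nat nat nat
  | Seq com com
  | IF test com com
  | WHILE test com

fun holds :: "test \<Rightarrow> state \<Rightarrow> bool" where
  "holds (Eq x y) s \<longleftrightarrow> reg s x = reg s y"
| "holds (Less x y) s \<longleftrightarrow> reg s x < reg s y"
| "holds (WLess x y) s \<longleftrightarrow> wt s (reg s x) < wt s (reg s y)"

definition set_reg :: "nat \<Rightarrow> nat \<Rightarrow> state \<Rightarrow> state" where
  "set_reg x k s = s\<lparr>reg := (reg s)(x := k)\<rparr>"

definition set_mem :: "nat \<Rightarrow> nat \<Rightarrow> nat \<Rightarrow> state \<Rightarrow> state" where
  "set_mem a i k s = s\<lparr>mem := (mem s)(a := (mem s a)(i := k))\<rparr>"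

text \<open>\<open>exec c s t s'\<close>: started in \<open>s\<close>, the program \<open>c\<close> halts in \<open>s'\<close> after \<open>t\<close> steps, where every
  basic instruction and every evaluation of a test is one step.\<close>

inductive exec :: "com \<Rightarrow> state \<Rightarrow> nat \<Rightarrow> state \<Rightarrow> bool" where
  exec_SKIP: "exec SKIP s 1 s"
| exec_Const: "exec (Const x k) s 1 (set_reg x k s)"
| exec_Copy: "exec (Copy x y) s 1 (set_reg x (reg s y) s)"
| exec_Inc: "exec (Inc x) s 1 (set_reg x (reg s x + 1) s)"
| exec_Dec: "exec (Dec x) s 1 (set_reg x (reg s x - 1) s)"
| exec_Load: "exec (Load x a y) s 1 (set_reg x (mem s a (reg s y)) s)"
| exec_Store: "exec (Store a x y) s 1 (set_mem a (reg s x) (reg s y) s)"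
| exec_Seq: "exec c1 s t1 s' \<Longrightarrow> exec c2 s' t2 s'' \<Longrightarrow> exec (Seq c1 c2) s (t1 + t2) s''"
| exec_IF_True: "holds b s \<Longrightarrow> exec c1 s t s' \<Longrightarrow> exec (IF b c1 c2) s (1 + t) s'"
| exec_IF_False: "\<not> holds b s \<Longrightarrow> exec c2 s t s' \<Longrightarrow> exec (IF b c1 c2) s (1 + t) s'"
| exec_WHILE_False: "\<not> holds b s \<Longrightarrow> exec (WHILE b c) s 1 s"
| exec_WHILE_True: "holds b s \<Longrightarrow> exec c s t1 s' \<Longrightarrow> exec (WHILE b c) s' t2 s'' \<Longrightarrow>
    exec (WHILE b c) s (1 + t1 + t2) s''"

inductive_cases exec_SKIP_E: "exec SKIP s t s'"
inductive_cases exec_Const_E: "exec (Const x k) s t s'"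
inductive_cases exec_Copy_E: "exec (Copy x y) s t s'"
inductive_cases exec_Inc_E: "exec (Inc x) s t s'"
inductive_cases exec_Dec_E: "exec (Dec x) s t s'"
inductive_cases exec_Load_E: "exec (Load x a y) s t s'"
inductive_cases exec_Store_E: "exec (Store a x y) s t s'"
inductive_cases exec_Seq_E: "exec (Seq c1 c2) s t s'"
inductive_cases exec_IF_E: "exec (IF b c1 c2) s t s'"
inductive_cases exec_WHILE_E: "exec (WHILE b c) s t s'"

lemma exec_deterministic: "exec c s t s1 \<Longrightarrow> exec c s t' s2 \<Longrightarrow> t' = t \<and> s2 = s1"
proof (induction arbitrary: t' s2 rule: exec.induct)
  case (exec_SKIP s)
  from exec_SKIP.prems show ?case by (rule exec_SKIP_E) simp
next
  case (exec_Const x k s)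
  from exec_Const.prems show ?case by (rule exec_Const_E) simp
next
  case (exec_Copy x y s)
  from exec_Copy.prems show ?case by (rule exec_Copy_E) simp
next
  case (exec_Inc x s)
  from exec_Inc.prems show ?case by (rule exec_Inc_E) simp
next
  case (exec_Dec x s)
  from exec_Dec.prems show ?case by (rule exec_Dec_E) simp
next
  case (exec_Load x a y s)
  from exec_Load.prems show ?case by (rule exec_Load_E) simp
next
  case (exec_Store a x y s)
  from exec_Store.prems show ?case by (rule exec_Store_E) simp
next
  case (exec_Seq c1 s t1 s' c2 t2 s'')
  from exec_Seq.prems show ?case
  proof (rule exec_Seq_E)
    fix u1 r u2
    assume "t' = u1 + u2" "exec c1 s u1 r" "exec c2 r u2 s2"
    with exec_Seq.IH(1)[of u1 r] exec_Seq.IH(2)[of u2 s2] show ?thesis by simp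
  qed
next
  case (exec_IF_True b s c1 t s' c2)
  from exec_IF_True.prems show ?case
  proof (rule exec_IF_E)
    fix u assume "t' = Suc u" "exec c1 s u s2"
    with exec_IF_True.IH[of u s2] show ?thesis by simp
  next
    assume "\<not> holds b s"
    with exec_IF_True.hyps(1) show ?thesis by simp
  qed
next
  case (exec_IF_False b s c2 t s' c1)
  from exec_IF_False.prems show ?case
  proof (rule exec_IF_E)
    assume "holds b s"
    with exec_IF_False.hyps(1) show ?thesis by simp
  next
    fix u assume "t' = Suc u" "exec c2 s u s2"
    with exec_IF_False.IH[of u s2] show ?thesis by simp
  qed
next
  case (exec_WHILE_False b s c)
  from exec_WHILE_False.prems show ?case
  proof (rule exec_WHILE_E)
    assume "t' = Suc 0" "s2 = s" then show ?thesis by simp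
  next
    assume "holds b s"
    with exec_WHILE_False.hyps show ?thesis by simp
  qed
next
  case (exec_WHILE_True b s c t1 s' t2 s'')
  from exec_WHILE_True.prems show ?case
  proof (rule exec_WHILE_E)
    assume "\<not> holds b s"
    with exec_WHILE_True.hyps(1) show ?thesis by simp
  next
    fix u1 r u2
    assume "t' = Suc (u1 + u2)" "exec c s u1 r" "exec (WHILE b c) r u2 s2"
    with exec_WHILE_True.IH(1)[of u1 r] exec_WHILE_True.IH(2)[of u2 s2] show ?thesis by simp
  qed
qed

text \<open>
  A digraph with vertices \<open>0, \<dots>, n - 1\<close> and arcs \<open>0, \<dots>, m - 1\<close> is given by \<open>n\<close>, \<open>m\<close> and the root
  in registers 0, 1, 2, by the tails and heads of the arcs in arrays 0 and 1 (in no particular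
  order), and by the weights. All other cells are 0. The computed arc set is read off array 2 as a
  characteristic vector.
\<close>

definition initial_state :: "(nat, nat) pre_digraph \<Rightarrow> nat \<Rightarrow> (nat \<Rightarrow> rat) \<Rightarrow> state" where
  "initial_state D r w = \<lparr>
     reg = (\<lambda>_. 0)(0 := card (verts D), 1 := card (arcs D), 2 := r),
     mem = (\<lambda>_ _. 0)(0 := (\<lambda>e. if e \<in> arcs D then tail D e else 0),
                     1 := (\<lambda>e. if e \<in> arcs D then head D e else 0)),
     wt = (\<lambda>e. if e \<in> arcs D then w e else 0)\<rparr>"

definition output_arcs :: "state \<Rightarrow> nat set" where
  "output_arcs s = {e. mem s 2 e \<noteq> 0}"

end

theory Submission
  imports Defs
begin

text \<open>
  Call a set \<open>B\<close> of arcs into \<open>v\<close> linkable if it is the set of last arcs of arc-disjoint paths from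
  \<open>r\<close> to \<open>v\<close>. The linkable sets of \<open>v\<close> are the independent sets of a matroid of rank \<open>\<lambda>\<^sub>D(r, v)\<close>, and a
  maximal flame contains a basis of it at every \<open>v \<noteq> r\<close>. In an acyclic digraph the converse
  holds: bases chosen independently at all vertices form a maximal flame. Indeed, by submodularity of
  cuts, the arcs into the vertices can be cut down to the chosen bases one vertex at a
  time, in reverse topological order, without lowering any local connectivity. A maximal flame
  of minimum weight therefore consists of a minimum weight basis at every vertex.

  Such a basis is found greedily. A flow from \<open>r\<close> to \<open>v\<close> whose last arcs are the accepted ones is
  maintained; an arc is accepted if its tail is reachable from \<open>r\<close> in the residual digraph without
  \<open>v\<close>, and otherwise the unreachable vertices form a cut showing that the arc can be rejected forever.
  Every arc causes one search in time linear in the number of arcs.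
\<close>

section \<open>Cuts, flows and flames\<close>

text \<open>The time bound depends on \<open>m\<close> alone while \<open>n\<close> is unrestricted,
  so no loop may run over the vertices. They are met only as ends of arcs: the outer loop visits
  heads, visited marks are cleared at the destinations of darts, and a search queue has length at
  most \<open>2 * m + 1\<close>. The budget of O(m) steps per arc also pays for a linear scan for
  the lightest remaining arc into the current vertex, which replaces sorting. Linkability is stated
  by cuts because uncrossing and exchange then both reduce to submodularity of
  \<open>entering\<close>, and no matroid axiom has to be established; Menger's theorem serves only
  to translate cuts into \<open>arc_conn\<close>. The search has to avoid \<open>v\<close>: a
  residual path through \<open>v\<close> could replace an accepted arc, whereas greedy acceptance is
  final. The definition of a maximal flame does not constrain the arcs into \<open>r\<close>; since
  weights are nonnegative, taking none of them is optimal.\<close>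

context fin_digraph
begin

abbreviation into :: "'b set \<Rightarrow> 'a \<Rightarrow> 'b set" where
  "into A u \<equiv> {a \<in> A. head G a = u}"

abbreviation outof :: "'b set \<Rightarrow> 'a \<Rightarrow> 'b set" where
  "outof A u \<equiv> {a \<in> A. tail G a = u}"

definition entering :: "'b set \<Rightarrow> 'a set \<Rightarrow> 'b set" where
  "entering A W = {a \<in> A. tail G a \<notin> W \<and> head G a \<in> W}"

text \<open>The cut side of Menger's theorem, phrased without a minimum so that it can be
  transferred between arc sets cut by cut.\<close>

definition cuts_ge :: "'b set \<Rightarrow> 'a \<Rightarrow> 'a \<Rightarrow> nat \<Rightarrow> bool" where
  "cuts_ge A r v k \<longleftrightarrow> (\<forall>W. v \<in> W \<longrightarrow> r \<notin> W \<longrightarrow> k \<le> card (entering A W))"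

text \<open>A unit-capacity integral flow, identified with its support. Circulations are allowed,
  and the value is the net inflow at \<open>v\<close>.\<close>

definition flow :: "'a \<Rightarrow> 'a \<Rightarrow> 'b set \<Rightarrow> bool" where
  "flow r v f \<longleftrightarrow> f \<subseteq> arcs G \<and> (\<forall>u. u \<noteq> r \<longrightarrow> u \<noteq> v \<longrightarrow> card (into f u) = card (outof f u))"

lemma finite_entering [simp]: "finite A \<Longrightarrow> finite (entering A W)"
  by (simp add: entering_def)

lemma entering_mono: "A \<subseteq> B \<Longrightarrow> entering A W \<subseteq> entering B W"
  by (auto simp: entering_def)

lemma cuts_geD: "cuts_ge A r v k \<Longrightarrow> v \<in> W \<Longrightarrow> r \<notin> W \<Longrightarrow> k \<le> card (entering A W)"
  by (auto simp: cuts_ge_def)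

lemma finite_arc_subset: "A \<subseteq> arcs G \<Longrightarrow> finite A"
  using finite_subset finite_arcs by blast

text \<open>An arc entering \<open>W \<inter> X\<close> or \<open>W \<union> X\<close> enters
  \<open>W\<close> or \<open>X\<close>, and an arc entering both of the former enters both of the
  latter.\<close>

lemma card_entering_submodular:
  assumes "finite A"
  shows "card (entering A (W \<inter> X)) + card (entering A (W \<union> X))
           \<le> card (entering A W) + card (entering A X)"
proof -
  let ?e = "entering A"
  have "card (?e (W \<inter> X)) + card (?e (W \<union> X))
      = card (?e (W \<inter> X) \<union> ?e (W \<union> X)) + card (?e (W \<inter> X) \<inter> ?e (W \<union> X))"
    using assms by (intro card_Un_Int) auto
  also have "\<dots> \<le> card (?e W \<union> ?e X) + card (?e W \<inter> ?e X)"
    using assms by (intro add_mono card_mono) (auto simp: entering_def)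
  also have "\<dots> = card (?e W) + card (?e X)"
    using assms by (intro card_Un_Int[symmetric]) auto
  finally show ?thesis .
qed

text \<open>Cuts are arbitrary sets, often complements and possibly infinite; intersecting with
  \<open>verts G\<close> makes the sum finite.\<close>

lemma card_by_vertex:
  assumes "f \<subseteq> arcs G" "\<And>a. a \<in> arcs G \<Longrightarrow> h a \<in> verts G"
  shows "card {a \<in> f. h a \<in> W} = (\<Sum>u \<in> W \<inter> verts G. card {a \<in> f. h a = u})"
proof -
  have "{a \<in> f. h a \<in> W} = (\<Union>u \<in> W \<inter> verts G. {a \<in> f. h a = u})"
    using assms by auto
  also have "card \<dots> = (\<Sum>u \<in> W \<inter> verts G. card {a \<in> f. h a = u})"
    using finite_arc_subset[OF assms(1)] by (intro card_UN_disjoint) auto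
  finally show ?thesis .
qed

text \<open>Conservation is summed over \<open>W\<close>: arcs inside \<open>W\<close> cancel and
  only \<open>v\<close> leaves a net term. Additions on both sides avoid truncated
  subtraction.\<close>

lemma flow_cut:
  assumes "flow r v f" "v \<in> W" "r \<notin> W"
  shows "card (entering f W) + card (outof f v) = card (entering f (- W)) + card (into f v)"
proof -
  have f: "f \<subseteq> arcs G" and fin: "finite f"
    using assms finite_arc_subset by (auto simp: flow_def)
  have eq: "card (into f u) = card (outof f u)" if "u \<in> W" "u \<noteq> v" for u
    using assms that by (auto simp: flow_def)
  have 1: "card {a \<in> f. head G a \<in> W} + card (outof f v)
      = card {a \<in> f. tail G a \<in> W} + card (into f v)"
  proof (cases "v \<in> verts G")
    case True
    let ?S = "W \<inter> verts G - {v}"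
    have split: "(\<Sum>u \<in> W \<inter> verts G. g u) = g v + sum g ?S" for g :: "'a \<Rightarrow> nat"
      using True assms by (intro sum.remove) auto
    have "(\<Sum>u \<in> ?S. card (into f u)) = (\<Sum>u \<in> ?S. card (outof f u))"
      by (rule sum.cong) (auto simp: eq)
    then show ?thesis
      using card_by_vertex[OF f, of "head G" W] card_by_vertex[OF f, of "tail G" W]
      by (simp add: split)
  next
    case False
    then have "into f v = {}" "outof f v = {}" using f by auto
    moreover have "(\<Sum>u \<in> W \<inter> verts G. card (into f u)) = (\<Sum>u \<in> W \<inter> verts G. card (outof f u))"
      by (rule sum.cong) (use False in \<open>auto intro!: eq\<close>)
    ultimately show ?thesis
      using card_by_vertex[OF f, of "head G" W] card_by_vertex[OF f, of "tail G" W]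
      by (simp add: \<open>into f v = {}\<close> \<open>outof f v = {}\<close>)
  qed
  let ?I = "{a \<in> f. head G a \<in> W \<and> tail G a \<in> W}"
  have "{a \<in> f. head G a \<in> W} = entering f W \<union> ?I" "entering f W \<inter> ?I = {}"
    by (auto simp: entering_def)
  then have 2: "card {a \<in> f. head G a \<in> W} = card (entering f W) + card ?I"
    using fin by (simp add: card_Un_disjoint)
  have "{a \<in> f. tail G a \<in> W} = entering f (- W) \<union> ?I" "entering f (- W) \<inter> ?I = {}"
    by (auto simp: entering_def)
  then have "card {a \<in> f. tail G a \<in> W} = card (entering f (- W)) + card ?I"
    using fin by (simp add: card_Un_disjoint)
  with 1 2 show ?thesis by simp
qed



subsection \<open>Menger's theorem\<close>

definition tight :: "'b set \<Rightarrow> 'a \<Rightarrow> 'a \<Rightarrow> nat \<Rightarrow> 'a set \<Rightarrow> bool" where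
  "tight A r v k W \<longleftrightarrow> v \<in> W \<and> r \<notin> W \<and> card (entering A W) = k"

text \<open>Both cuts have at least \<open>k\<close> arcs, and by submodularity at most
  \<open>2 * k\<close> together.\<close>

lemma tight_Un_Int:
  assumes "finite A" "cuts_ge A r v k" "tight A r v k W" "tight A r v k X"
  shows "tight A r v k (W \<union> X)" "tight A r v k (W \<inter> X)"
proof -
  have "k \<le> card (entering A (W \<inter> X))" "k \<le> card (entering A (W \<union> X))"
    using assms by (auto simp: cuts_ge_def tight_def)
  with card_entering_submodular[OF assms(1), of W X] assms(3,4)
  show "tight A r v k (W \<union> X)" "tight A r v k (W \<inter> X)"
    by (auto simp: tight_def)
qed

lemma tight_Union_Inter:
  assumes "finite A" "cuts_ge A r v k" "finite S" "S \<noteq> {}" "\<And>W. W \<in> S \<Longrightarrow> tight A r v k W"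
  shows "tight A r v k (\<Union>S) \<and> tight A r v k (\<Inter>S)"
  using assms(3-5)
  by (induction S rule: finite_ne_induct) (auto intro: tight_Un_Int[OF assms(1,2)])

text \<open>
  In an inclusion-minimal arc set with all cuts of size at least \<open>k\<close>, every arc enters a tight set.
  For a vertex \<open>u\<close>, uncrossing gives one tight set entered by all arcs into \<open>u\<close> and one, not
  containing \<open>u\<close>, entered by all arcs out of \<open>u\<close>. Removing or adding \<open>u\<close> shows that \<open>u\<close> is balanced.
\<close>

lemma cuts_ge_imp_flow:
  assumes "A \<subseteq> arcs G" "cuts_ge A r v k" "r \<noteq> v"
  obtains f where "f \<subseteq> A" "flow r v f" "card (into f v) = k" "outof f v = {}"
proof -
  have "finite A" using assms finite_arc_subset by blast
  then have "\<exists>f. f \<subseteq> A \<and> cuts_ge f r v k \<and> (\<forall>g. g \<subset> f \<longrightarrow> \<not> cuts_ge g r v k)"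
    using assms(2)
  proof (induction A rule: finite_psubset_induct)
    case (psubset A)
    then show ?case by (metis order_refl order_trans psubset_imp_subset)
  qed
  then obtain f where f: "f \<subseteq> A" "cuts_ge f r v k" and min: "\<And>g. g \<subset> f \<Longrightarrow> \<not> cuts_ge g r v k"
    by blast
  have farcs: "f \<subseteq> arcs G" and fin: "finite f" using f assms finite_arc_subset by auto
  have "\<exists>W. tight f r v k W \<and> tail G a \<notin> W \<and> head G a \<in> W" if a: "a \<in> f" for a
  proof -
    have "\<not> cuts_ge (f - {a}) r v k" using min a by blast
    then obtain W where W: "v \<in> W" "r \<notin> W" "card (entering (f - {a}) W) < k"
      by (auto simp: cuts_ge_def not_le)
    have ge: "k \<le> card (entering f W)" using f W by (auto simp: cuts_ge_def)
    have e: "entering (f - {a}) W = entering f W - {a}" by (auto simp: entering_def)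
    have "a \<in> entering f W" using W(3) ge e by (metis Diff_empty Diff_insert0 not_le)
    moreover from this have "card (entering f W) = k"
      using W(3) ge fin e by simp
    ultimately show ?thesis using W by (auto simp: tight_def entering_def)
  qed
  then obtain T where T: "\<And>a. a \<in> f \<Longrightarrow> tight f r v k (T a) \<and> tail G a \<notin> T a \<and> head G a \<in> T a"
    by metis
  have in_le: "\<exists>X. tight f r v k X \<and> u \<in> X \<and> into f u \<subseteq> entering f X" if "into f u \<noteq> {}" for u
  proof (intro exI conjI)
    show "tight f r v k (\<Inter> (T ` into f u))"
      using tight_Union_Inter[OF fin f(2), of "T ` into f u"] that T fin by auto
    show "u \<in> \<Inter> (T ` into f u)" using T by auto
    show "into f u \<subseteq> entering f (\<Inter> (T ` into f u))" using T that by (fastforce simp: entering_def)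
  qed
  have out_le: "\<exists>X. tight f r v k X \<and> u \<notin> X \<and> outof f u \<subseteq> entering f X" if "outof f u \<noteq> {}" for u
  proof (intro exI conjI)
    show "tight f r v k (\<Union> (T ` outof f u))"
      using tight_Union_Inter[OF fin f(2), of "T ` outof f u"] that T fin by auto
    show "u \<notin> \<Union> (T ` outof f u)" using T by fastforce
    show "outof f u \<subseteq> entering f (\<Union> (T ` outof f u))" using T that by (fastforce simp: entering_def)
  qed
  have "card (into f u) = card (outof f u)" if u: "u \<noteq> r" "u \<noteq> v" for u
  proof (rule antisym)
    show "card (into f u) \<le> card (outof f u)"
    proof (cases "into f u = {}")
      case False
      then obtain X where X: "tight f r v k X" "u \<in> X" "into f u \<subseteq> entering f X"
        using in_le by blast
      have "k \<le> card (entering f (X - {u}))"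
        using f X u by (intro cuts_geD) (auto simp: tight_def)
      also have "\<dots> \<le> card ((entering f X - into f u) \<union> outof f u)"
        using fin by (intro card_mono) (auto simp: entering_def)
      also have "\<dots> \<le> card (entering f X - into f u) + card (outof f u)"
        by (rule card_Un_le)
      also have "card (entering f X - into f u) = k - card (into f u)"
        using X fin by (simp add: card_Diff_subset tight_def)
      finally show ?thesis
        using card_mono[OF _ X(3)] fin X(1) by (auto simp: tight_def)
    qed (simp only: card.empty le0)
    show "card (outof f u) \<le> card (into f u)"
    proof (cases "outof f u = {}")
      case False
      then obtain X where X: "tight f r v k X" "u \<notin> X" "outof f u \<subseteq> entering f X"
        using out_le by blast
      have "k \<le> card (entering f (insert u X))"
        using f X u by (intro cuts_geD) (auto simp: tight_def)
      also have "\<dots> \<le> card ((entering f X - outof f u) \<union> into f u)"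
        using fin by (intro card_mono) (auto simp: entering_def)
      also have "\<dots> \<le> card (entering f X - outof f u) + card (into f u)"
        by (rule card_Un_le)
      also have "card (entering f X - outof f u) = k - card (outof f u)"
        using X fin by (simp add: card_Diff_subset tight_def)
      finally show ?thesis
        using card_mono[OF _ X(3)] fin X(1) by (auto simp: tight_def)
    qed (simp only: card.empty le0)
  qed
  then have "flow r v f" using farcs by (auto simp: flow_def)
  \<comment> \<open>Every tight set contains \<open>v\<close>, but an arc out of \<open>v\<close>
    would yield one avoiding \<open>v\<close>.\<close>
  moreover have "outof f v = {}" using out_le[of v] by (auto simp: tight_def)
  moreover have "card (into f v) = k"
  proof (rule antisym)
    show "card (into f v) \<le> k"
    proof (cases "into f v = {}")
      case False
      then obtain X where X: "tight f r v k X" "into f v \<subseteq> entering f X"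
        using in_le by blast
      then show ?thesis using card_mono[OF _ X(2)] fin by (auto simp: tight_def)
    qed (simp only: card.empty le0)
    have "k \<le> card (entering f {v})" using f assms by (intro cuts_geD) auto
    also have "\<dots> \<le> card (into f v)" using fin by (intro card_mono) (auto simp: entering_def)
    finally show "k \<le> card (into f v)" .
  qed
  ultimately show ?thesis using that f by blast
qed

section \<open>Spanning subgraphs, and decomposition of flows into arc-disjoint paths\<close>

lemma fin_digraph_spanning:
  assumes "A \<subseteq> arcs G" shows "fin_digraph (spanning_subgraph G A)"
  using assms finite_arc_subset[OF assms] by unfold_locales auto

lemma cas_spanning: "pre_digraph.cas (spanning_subgraph G A) u p v = cas u p v"
  by (induction p arbitrary: u) (auto simp: pre_digraph.cas.simps)

lemma awalk_spanning:
  "A \<subseteq> arcs G \<Longrightarrow> pre_digraph.awalk (spanning_subgraph G A) u p v \<longleftrightarrow> awalk u p v \<and> set p \<subseteq> A"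
  by (auto simp: pre_digraph.awalk_def cas_spanning)

lemma apath_spanning:
  assumes "A \<subseteq> arcs G"
  shows "pre_digraph.apath (spanning_subgraph G A) u p v \<longleftrightarrow> apath u p v \<and> set p \<subseteq> A"
proof -
  have "pre_digraph.awalk_verts (spanning_subgraph G A) u p = awalk_verts u p"
    by (induction p arbitrary: u) (auto simp: pre_digraph.awalk_verts.simps)
  then show ?thesis
    using awalk_spanning[OF assms] by (auto simp: pre_digraph.apath_def)
qed

text \<open>Arcs of a trail are distinct, so counting them as a set loses nothing. Writing the end
  corrections on both sides also covers \<open>u = v\<close>.\<close>

lemma trail_balance:
  assumes "trail u p v"
  shows "card (into (set p) x) + (if x = u then 1 else 0) = card (outof (set p) x) + (if x = v then 1 else 0)"
  using assms
proof (induction p arbitrary: u)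
  case (Cons e p)
  then have e: "tail G e = u" "e \<notin> set p" and tr: "trail (head G e) p v"
    by (auto simp: trail_Cons_iff)
  have "into (set (e # p)) x = (if head G e = x then insert e (into (set p) x) else into (set p) x)"
    "outof (set (e # p)) x = (if tail G e = x then insert e (outof (set p) x) else outof (set p) x)"
    by auto
  with Cons.IH[OF tr] e show ?case by (auto split: if_splits)
qed (auto simp: trail_Nil_iff)

lemma apath_imp_trail: "apath u p v \<Longrightarrow> trail u p v"
  by (auto simp: trail_def apath_def dest: distinct_verts_imp_distinct)

text \<open>Paths are peeled off one at a time. If \<open>v\<close> were unreachable inside
  \<open>f\<close>, no flow would enter the set of unreachable vertices, contradicting its positive
  net inflow. Later paths live in \<open>f - set p\<close>, which makes them disjoint from
  \<open>p\<close>.\<close>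

lemma flow_imp_paths:
  assumes "flow r v f" "r \<noteq> v" "r \<in> verts G" "v \<in> verts G" "card (into f v) = card (outof f v) + k"
  shows "\<exists>P. arc_disjoint_paths (spanning_subgraph G f) r v P \<and> finite P \<and> card P = k"
  using assms(1,5)
proof (induction k arbitrary: f)
  case 0
  show ?case by (rule exI[of _ "{}"]) (simp add: arc_disjoint_paths_def)
next
  case (Suc k)
  have f: "f \<subseteq> arcs G" and fin: "finite f" using Suc.prems finite_arc_subset by (auto simp: flow_def)
  interpret H: fin_digraph "spanning_subgraph G f" by (rule fin_digraph_spanning[OF f])
  have "r \<rightarrow>\<^sup>*\<^bsub>spanning_subgraph G f\<^esub> v"
  proof (rule ccontr)
    let ?W = "{x. \<not> r \<rightarrow>\<^sup>*\<^bsub>spanning_subgraph G f\<^esub> x}"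
    assume "\<not> ?thesis"
    moreover have "r \<notin> ?W" using assms by auto
    moreover have "entering f ?W = {}"
    proof -
      have "r \<rightarrow>\<^sup>*\<^bsub>spanning_subgraph G f\<^esub> head G a" if "a \<in> f" "r \<rightarrow>\<^sup>*\<^bsub>spanning_subgraph G f\<^esub> tail G a" for a
        using that H.reachable_adj_trans H.in_arcs_imp_in_arcs_ends[of a] by auto
      then show ?thesis by (auto simp: entering_def)
    qed
    ultimately show False using flow_cut[OF Suc.prems(1), of ?W] Suc.prems(2) by simp
  qed
  then obtain p where p': "H.apath r p v" by (metis H.reachable_awalk H.apath_awalk_to_apath)
  then have p: "apath r p v" "set p \<subseteq> f" using apath_spanning[OF f] by auto
  have p_ne: "p \<noteq> []" using p assms(2) by (auto simp: apath_Nil_iff)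
  let ?g = "f - set p"
  have in_g: "card (into ?g x) + card (into (set p) x) = card (into f x)"
   and out_g: "card (outof ?g x) + card (outof (set p) x) = card (outof f x)" for x
  proof -
    have "into f x = into ?g x \<union> into (set p) x" "outof f x = outof ?g x \<union> outof (set p) x"
      using p by auto
    moreover have "into ?g x \<inter> into (set p) x = {}" "outof ?g x \<inter> outof (set p) x = {}"
      by auto
    ultimately show "card (into ?g x) + card (into (set p) x) = card (into f x)"
      "card (outof ?g x) + card (outof (set p) x) = card (outof f x)"
      using fin by (simp_all add: card_Un_disjoint)
  qed
  note bal = trail_balance[OF apath_imp_trail[OF p(1)]]
  have "flow r v ?g"
    unfolding flow_def
  proof (intro conjI allI impI)
    fix u assume "u \<noteq> r" "u \<noteq> v"
    then show "card (into ?g u) = card (outof ?g u)"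
      using in_g[of u] out_g[of u] bal[of u] Suc.prems(1) by (auto simp: flow_def)
  qed (use f in auto)
  moreover have "card (into ?g v) = card (outof ?g v) + k"
    using in_g[of v] out_g[of v] bal[of v] Suc.prems(2) assms(2) by auto
  ultimately obtain P where P: "arc_disjoint_paths (spanning_subgraph G ?g) r v P" "finite P" "card P = k"
    using Suc.IH by blast
  have Pg: "apath r q v" "set q \<subseteq> ?g" if "q \<in> P" for q
  proof -
    have "?g \<subseteq> arcs G" using f by auto
    from apath_spanning[OF this] show "apath r q v" "set q \<subseteq> ?g"
      using P(1) that unfolding arc_disjoint_paths_def by blast+
  qed
  have "p \<notin> P" using Pg(2)[of p] p_ne by (cases p) auto
  then have "card (insert p P) = Suc k" using P by simp
  moreover have "arc_disjoint_paths (spanning_subgraph G f) r v (insert p P)"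
    unfolding arc_disjoint_paths_def
  proof (intro conjI ballI)
    fix q assume "q \<in> insert p P"
    then show "H.apath r q v" using p' Pg apath_spanning[OF f] by auto
  next
    show "pairwise (\<lambda>p q. set p \<inter> set q = {}) (insert p P)"
      using P(1) Pg(2) unfolding pairwise_insert arc_disjoint_paths_def by blast
  qed
  ultimately show ?case using P(2) by (metis finite.insertI)
qed

lemma cas_crosses:
  assumes "cas u p v" "u \<notin> W" "v \<in> W"
  shows "\<exists>a \<in> set p. tail G a \<notin> W \<and> head G a \<in> W"
  using assms by (induction u p v rule: cas.induct) auto

text \<open>Every path crosses into \<open>W\<close>; choosing one crossing arc per path is
  injective by disjointness. Finiteness of \<open>P\<close> comes out of the same injection.\<close>

lemma card_paths_le_cut:
  assumes "A \<subseteq> arcs G" "arc_disjoint_paths (spanning_subgraph G A) r v P" "v \<in> W" "r \<notin> W"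
  shows "finite P" "card P \<le> card (entering A W)"
proof -
  have P: "apath r p v \<and> set p \<subseteq> A" if "p \<in> P" for p
    using that assms apath_spanning by (auto simp: arc_disjoint_paths_def)
  then have "\<exists>a. a \<in> set p \<and> a \<in> entering A W" if "p \<in> P" for p
    using cas_crosses[of r p v W] assms that by (fastforce simp: apath_def awalk_def entering_def)
  then obtain c where c: "\<And>p. p \<in> P \<Longrightarrow> c p \<in> set p \<and> c p \<in> entering A W"
    by metis
  then have inj: "inj_on c P"
    using assms(2) by (fastforce simp: inj_on_def arc_disjoint_paths_def pairwise_def)
  have fin: "finite (entering A W)" using assms finite_arc_subset by auto
  have sub: "c ` P \<subseteq> entering A W" using c by auto
  from fin sub inj show "finite P" by (meson finite_imageD finite_subset)
  from fin sub inj show "card P \<le> card (entering A W)" by (metis card_image card_mono)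
qed

text \<open>Justifies the \<open>Max\<close> in \<open>arc_conn\<close>: the cut \<open>{v}\<close>
  bounds the sizes, and the empty family shows that there are some.\<close>

lemma arc_conn_attained:
  assumes "A \<subseteq> arcs G" "r \<noteq> v"
  shows "finite {card P |P. arc_disjoint_paths (spanning_subgraph G A) r v P}"
    and "\<exists>P. arc_disjoint_paths (spanning_subgraph G A) r v P
           \<and> card P = arc_conn (spanning_subgraph G A) r v"
proof -
  let ?S = "{card P |P. arc_disjoint_paths (spanning_subgraph G A) r v P}"
  have "?S \<subseteq> {..card (entering A {v})}"
    using card_paths_le_cut[OF assms(1), where W = "{v}"] assms by auto
  then show fin: "finite ?S" using finite_subset by blast
  have "card ({} :: 'b list set) \<in> ?S"
    by (intro CollectI exI[of _ "{}"]) (simp add: arc_disjoint_paths_def)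
  then have "?S \<noteq> {}" by blast
  from Max_in[OF fin this]
  show "\<exists>P. arc_disjoint_paths (spanning_subgraph G A) r v P
           \<and> card P = arc_conn (spanning_subgraph G A) r v"
    unfolding arc_conn_def by auto
qed

lemma arc_conn_le_cut:
  assumes "A \<subseteq> arcs G" "v \<in> W" "r \<notin> W"
  shows "arc_conn (spanning_subgraph G A) r v \<le> card (entering A W)"
proof -
  have "r \<noteq> v" using assms by auto
  then obtain P where "arc_disjoint_paths (spanning_subgraph G A) r v P"
      "card P = arc_conn (spanning_subgraph G A) r v"
    using arc_conn_attained(2)[OF assms(1)] by blast
  then show ?thesis using card_paths_le_cut(2)[OF assms(1) _ assms(2,3)] by metis
qed

lemma arc_conn_ge_cuts:
  assumes "A \<subseteq> arcs G" "cuts_ge A r v k" "r \<noteq> v" "r \<in> verts G" "v \<in> verts G"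
  shows "k \<le> arc_conn (spanning_subgraph G A) r v"
proof -
  obtain f where f: "f \<subseteq> A" "flow r v f" "card (into f v) = k" "outof f v = {}"
    using cuts_ge_imp_flow[OF assms(1-3)] by blast
  have "card (outof f v) = 0" by (subst f(4)) simp
  then obtain P where P: "arc_disjoint_paths (spanning_subgraph G f) r v P" "card P = k"
    using flow_imp_paths[OF f(2), of k] assms f by auto
  have "f \<subseteq> arcs G" using f assms by auto
  then have "arc_disjoint_paths (spanning_subgraph G A) r v P"
    using P(1) f(1)
    unfolding arc_disjoint_paths_def apath_spanning[OF \<open>f \<subseteq> arcs G\<close>] apath_spanning[OF assms(1)]
    by blast
  then show ?thesis
    unfolding arc_conn_def using P arc_conn_attained(1)[OF assms(1,3)] by (intro Max_ge) auto
qed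

subsection \<open>Maximal flames from local bases\<close>

abbreviation arcs_via :: "'a \<Rightarrow> 'b set \<Rightarrow> 'b set" where
  "arcs_via v B \<equiv> arcs G - (in_arcs G v - B)"

text \<open>
  The arcs of \<open>B\<close>, all entering \<open>v\<close>, are the last arcs of arc-disjoint paths from \<open>r\<close> to \<open>v\<close>; this is
  stated by cuts rather than by paths, which is all that is needed.
\<close>

definition linkable :: "'a \<Rightarrow> 'a \<Rightarrow> 'b set \<Rightarrow> bool" where
  "linkable r v B \<longleftrightarrow> B \<subseteq> in_arcs G v \<and> cuts_ge (arcs_via v B) r v (card B)"

text \<open>A cut certificate of maximality: together with \<open>linkable\<close> it forces
  \<open>card B\<close> to be the connectivity from \<open>r\<close> to \<open>v\<close>.\<close>

definition saturated :: "'a \<Rightarrow> 'a \<Rightarrow> 'b set \<Rightarrow> bool" where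
  "saturated r v B \<longleftrightarrow> (\<exists>W. v \<in> W \<and> r \<notin> W \<and> card (entering (arcs G) W) \<le> card B)"

text \<open>On a finite digraph this makes the arc relation well-founded, which supplies the
  topological order used below.\<close>

lemma acyclic_arcs_ends:
  assumes "acyclic_digraph G"
  shows "acyclic (arcs_ends G)"
proof (rule acyclicI, rule allI, rule notI)
  fix x assume "x \<rightarrow>\<^sup>+ x"
  then obtain p where "awalk x p x" "p \<noteq> []" unfolding reachable1_awalk by blast
  then have "closed_w p" by (auto simp: closed_w_def)
  then show False using closed_w_imp_cycle assms by (auto simp: acyclic_digraph_def)
qed

lemma acyclic_loopfree:
  assumes "acyclic_digraph G" "a \<in> arcs G"
  shows "tail G a \<noteq> head G a"
  using acyclic_arcs_ends[OF assms(1)] in_arcs_imp_in_arcs_ends[OF assms(2)]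
  by (metis acyclic_def trancl.r_into_trancl)

text \<open>
  Let \<open>W\<close> be a minimum cut for \<open>u\<close>. The deleted arcs into \<open>u\<close> do not enter \<open>W\<close>, hence not
  \<open>X \<union> W\<close> either, and uncrossing compares \<open>X\<close> with \<open>X \<union> W\<close>.
\<close>

lemma cuts_ge_restrict:
  assumes "H' = H - (in_arcs G u - B)" "H \<subseteq> arcs G"
    and "u \<in> W" "r \<notin> W" "card (entering H W) \<le> b"
    and "cuts_ge H' r u b"
    and "cuts_ge H r x k"
  shows "cuts_ge H' r x k"
  unfolding cuts_ge_def
proof (intro allI impI)
  fix X assume X: "x \<in> X" "r \<notin> X"
  have fin: "finite H" "finite H'" using assms(1,2) finite_arc_subset by auto
  show "k \<le> card (entering H' X)"
  proof (cases "u \<in> X")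
    case False
    then have "entering H' X = entering H X"
      by (auto simp: entering_def assms(1) in_arcs_def)
    then show ?thesis using assms(7) X by (simp add: cuts_geD)
  next
    case True
    have sub: "entering H' W \<subseteq> entering H W" by (rule entering_mono) (simp add: assms(1))
    have "b \<le> card (entering H' W)" using assms by (intro cuts_geD[OF assms(6)])
    \<comment> \<open>The cut \<open>W\<close> has at most \<open>b\<close> arcs before the deletion
      and at least \<open>b\<close> after it, so it loses none.\<close>
    then have eq: "entering H' W = entering H W"
      using card_seteq[OF _ sub] fin assms(5) by simp
    have "entering H' (X \<union> W) = entering H (X \<union> W)"
    proof
      show "entering H (X \<union> W) \<subseteq> entering H' (X \<union> W)"
      proof
        fix a assume a: "a \<in> entering H (X \<union> W)"
        have "a \<in> H'"
        proof (rule ccontr)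
          assume "a \<notin> H'"
          then have "head G a = u" using a by (auto simp: assms(1) entering_def in_arcs_def)
          then have "a \<in> entering H W" using a assms(3) by (auto simp: entering_def)
          then have "a \<in> entering H' W" using eq by simp
          then show False using \<open>a \<notin> H'\<close> by (simp add: entering_def)
        qed
        then show "a \<in> entering H' (X \<union> W)" using a by (simp add: entering_def)
      qed
    qed (auto simp: entering_def assms(1))
    then have "k \<le> card (entering H' (X \<union> W))"
      using X assms(4) cuts_geD[OF assms(7), of "X \<union> W"] by simp
    moreover have "b \<le> card (entering H' (X \<inter> W))"
      using True X assms(3) by (intro cuts_geD[OF assms(6)]) auto
    moreover have "card (entering H' (X \<inter> W)) + card (entering H' (X \<union> W))
        \<le> card (entering H' X) + card (entering H' W)"
      by (rule card_entering_submodular[OF fin(2)])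
    moreover have "card (entering H' W) \<le> b" using eq assms(5) by simp
    ultimately show ?thesis by linarith
  qed
qed

text \<open>
  The sets of arcs into the vertices are replaced by the chosen ones in reverse topological order;
  \<open>L\<close> are the vertices still to be treated. Paths to the current vertex only use vertices of
  \<open>L\<close>, whose entering arcs are still complete.
\<close>

lemma cuts_ge_local_choice:
  assumes acyc: "acyclic_digraph G" and F: "F \<subseteq> arcs G"
    and link: "\<And>v. v \<in> verts G - {r} \<Longrightarrow> linkable r v (into F v)"
    and sat: "\<And>v. v \<in> verts G - {r} \<Longrightarrow> saturated r v (into F v)"
    and "L \<subseteq> verts G" and closed: "\<And>a. a \<in> arcs G \<Longrightarrow> head G a \<in> L \<Longrightarrow> tail G a \<in> L"
    and x: "cuts_ge (arcs G) r x k"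
  shows "cuts_ge {a \<in> arcs G. head G a \<in> L \<or> a \<in> F} r x k"
  using assms(5,6)
proof (induction "card (verts G - L)" arbitrary: L)
  case 0
  then have "L = verts G" by auto
  then have "{a \<in> arcs G. head G a \<in> L \<or> a \<in> F} = arcs G" by auto
  then show ?case using x by simp
next
  case (Suc j)
  have "wf (arcs_ends G)"
    using acyclic_arcs_ends[OF acyc] by (intro finite_acyclic_wf) (simp_all add: arcs_ends_def)
  moreover obtain y where "y \<in> verts G - L"
    using Suc.hyps(2) by (metis Suc_neq_Zero card.empty ex_in_conv)
  \<comment> \<open>As \<open>u\<close> is minimal outside \<open>L\<close>, all tails of arcs into
    \<open>u\<close> lie in \<open>L\<close>, so \<open>insert u L\<close> is again closed. The
    hypothesis for this larger set describes the state just before \<open>u\<close> is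
    treated.\<close>
  ultimately obtain u where u: "u \<in> verts G - L"
    and umin: "\<And>y. (y, u) \<in> arcs_ends G \<Longrightarrow> y \<notin> verts G - L"
    using wfE_min[of "arcs_ends G" y "verts G - L"] by metis
  let ?L = "insert u L"
  let ?H = "{a \<in> arcs G. head G a \<in> ?L \<or> a \<in> F}" and ?H' = "{a \<in> arcs G. head G a \<in> L \<or> a \<in> F}"
  let ?B = "into F u"
  have closed': "tail G a \<in> ?L" if "a \<in> arcs G" "head G a \<in> ?L" for a
    using that Suc.prems(2)[of a] umin[of "tail G a"] in_arcs_imp_in_arcs_ends[of a] by auto
  have "card (verts G - L) = Suc (card (verts G - ?L))"
    using u by (metis Diff_insert card_Suc_Diff1 finite_Diff finite_verts)
  then have IH: "cuts_ge ?H r x k"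
    using Suc.hyps u Suc.prems closed' by (intro Suc.hyps(1)) auto
  have H': "?H' = ?H - (in_arcs G u - ?B)" using u F by (auto simp: in_arcs_def)
  show ?case
  proof (cases "u = r")
    case True
    have "entering ?H' W = entering ?H W" if "r \<notin> W" for W
      using that True by (auto simp: entering_def)
    then show ?thesis using IH by (simp add: cuts_ge_def)
  next
    case False
    then have ur: "u \<in> verts G - {r}" using u by simp
    obtain W where W: "u \<in> W" "r \<notin> W" "card (entering (arcs G) W) \<le> card ?B"
      using sat[OF ur] by (auto simp: saturated_def)
    have "card (entering ?H W) \<le> card (entering (arcs G) W)"
      by (intro card_mono entering_mono) auto
    with W(3) have W': "card (entering ?H W) \<le> card ?B" by simp
    have "cuts_ge ?H' r u (card ?B)"
      unfolding cuts_ge_def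
    proof (intro allI impI)
      fix X assume X: "u \<in> X" "r \<notin> X"
      \<comment> \<open>Intersecting with \<open>?L\<close> discards cut arcs whose heads were
        already treated. Since \<open>?L\<close> is closed under tails, an arc entering
        \<open>X \<inter> ?L\<close> has its tail outside \<open>X\<close> and so enters
        \<open>X\<close> as well.\<close>
      have "card ?B \<le> card (entering (arcs_via u ?B) (X \<inter> ?L))"
        using link[OF ur] X by (intro cuts_geD[of _ r u]) (auto simp: linkable_def)
      also have "\<dots> \<le> card (entering ?H' X)"
      proof (intro card_mono subsetI)
        show "finite (entering ?H' X)" by simp
        fix a assume "a \<in> entering (arcs_via u ?B) (X \<inter> ?L)"
        then have a: "a \<in> arcs G" "head G a = u \<Longrightarrow> a \<in> ?B" "head G a \<in> X" "head G a \<in> ?L"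
            "tail G a \<notin> X \<inter> ?L"
          by (auto simp: entering_def in_arcs_def)
        then show "a \<in> entering ?H' X"
          using closed'[of a] by (auto simp: entering_def)
      qed
      finally show "card ?B \<le> card (entering ?H' X)" .
    qed
    from cuts_ge_restrict[OF H' _ W(1,2) W' this IH] show ?thesis by auto
  qed
qed

lemma linkable_imp_cuts_ge_arcs:
  assumes "linkable r v B" shows "cuts_ge (arcs G) r v (card B)"
  unfolding cuts_ge_def
proof (intro allI impI)
  fix W assume "v \<in> W" "r \<notin> W"
  then have "card B \<le> card (entering (arcs_via v B) W)"
    using assms by (auto simp: linkable_def cuts_ge_def)
  also have "\<dots> \<le> card (entering (arcs G) W)" by (intro card_mono entering_mono) auto
  finally show "card B \<le> card (entering (arcs G) W)" .
qed

lemma arc_conn_eq_card: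
  assumes "r \<in> verts G" "v \<in> verts G - {r}" "linkable r v B" "saturated r v B"
  shows "arc_conn G r v = card B"
proof (rule antisym)
  have G: "spanning_subgraph G (arcs G) = G" by simp
  show "arc_conn G r v \<le> card B"
    using assms(4) arc_conn_le_cut[of "arcs G" v _ r] unfolding G saturated_def
    by (meson order_refl order_trans)
  show "card B \<le> arc_conn G r v"
    using arc_conn_ge_cuts[of "arcs G" r v] linkable_imp_cuts_ge_arcs[OF assms(3)] assms(1,2)
    unfolding G by auto
qed

lemma maximal_flame_local:
  assumes "acyclic_digraph G" "F \<subseteq> arcs G" "r \<in> verts G"
    and "\<And>v. v \<in> verts G - {r} \<Longrightarrow> linkable r v (into F v)"
    and "\<And>v. v \<in> verts G - {r} \<Longrightarrow> saturated r v (into F v)"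
  shows "maximal_flame G r F"
  unfolding maximal_flame_def
proof (intro conjI ballI)
  fix v assume v: "v \<in> verts G - {r}"
  let ?H = "spanning_subgraph G F"
  have eq: "arc_conn G r v = card (into F v)"
    using arc_conn_eq_card assms v by blast
  have deg: "in_degree ?H v = card (into F v)"
    by (simp add: in_degree_def in_arcs_def)
  \<comment> \<open>With \<open>L = {}\<close> every vertex has been treated and exactly
    \<open>F\<close> remains.\<close>
  have "cuts_ge {a \<in> arcs G. head G a \<in> {} \<or> a \<in> F} r v (card (into F v))"
    by (intro cuts_ge_local_choice assms v linkable_imp_cuts_ge_arcs) auto
  moreover have "{a \<in> arcs G. head G a \<in> {} \<or> a \<in> F} = F" using assms(2) by auto
  ultimately have "card (into F v) \<le> arc_conn ?H r v"
    using arc_conn_ge_cuts[OF assms(2), of r v] assms(3) v by auto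
  moreover have "arc_conn ?H r v \<le> card (entering F {v})"
    using v assms(2) by (intro arc_conn_le_cut) auto
  moreover have "card (entering F {v}) \<le> card (into F v)"
    using finite_arc_subset[OF assms(2)] by (intro card_mono) (auto simp: entering_def)
  ultimately show "arc_conn G r v = arc_conn ?H r v" "arc_conn ?H r v = in_degree ?H v"
    using eq deg by auto
qed (use assms in auto)

text \<open>Needed for the lower bound: at every vertex a competing flame is a linkable set of the
  common size, hence comparable with the greedy basis.\<close>

lemma maximal_flame_linkable:
  assumes "maximal_flame G r F" "v \<in> verts G - {r}"
  shows "linkable r v (into F v)" "card (into F v) = arc_conn G r v"
proof -
  have F: "F \<subseteq> arcs G" using assms(1) by (simp add: maximal_flame_def)
  have deg: "in_degree (spanning_subgraph G F) v = card (into F v)"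
    by (simp add: in_degree_def in_arcs_def)
  then show "card (into F v) = arc_conn G r v"
    using assms by (simp add: maximal_flame_def)
  show "linkable r v (into F v)"
    unfolding linkable_def cuts_ge_def
  proof (intro conjI allI impI)
    fix W assume W: "v \<in> W" "r \<notin> W"
    have "card (into F v) \<le> card (entering F W)"
      using arc_conn_le_cut[OF F W] deg assms by (simp add: maximal_flame_def)
    also have "\<dots> \<le> card (entering (arcs_via v (into F v)) W)"
      using F by (intro card_mono entering_mono) (auto simp: in_arcs_def)
    finally show "card (into F v) \<le> card (entering (arcs_via v (into F v)) W)" .
  qed (use F in \<open>auto simp: in_arcs_def\<close>)
qed

definition optimal_basis :: "'a \<Rightarrow> ('b \<Rightarrow> rat) \<Rightarrow> 'a \<Rightarrow> 'b set \<Rightarrow> bool" where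
  "optimal_basis r w v B \<longleftrightarrow> linkable r v B \<and> saturated r v B \<and>
     (\<forall>X. linkable r v X \<longrightarrow> card X = card B \<longrightarrow> sum w B \<le> sum w X)"

text \<open>Grouping arcs by head splits the weight into independent local sums. Away from
  \<open>r\<close> they are compared by \<open>optimal_basis\<close>, at \<open>r\<close> by
  nonnegativity.\<close>

theorem min_weight_maximal_flame_local:
  assumes "acyclic_digraph G" "F \<subseteq> arcs G" "r \<in> verts G" "\<forall>a \<in> arcs G. 0 \<le> w a"
    and "into F r = {}"
    and opt: "\<And>v. v \<in> verts G - {r} \<Longrightarrow> optimal_basis r w v (into F v)"
  shows "min_weight_maximal_flame G r w F"
  unfolding min_weight_maximal_flame_def
proof (intro conjI allI impI)
  show "maximal_flame G r F"
    using assms by (intro maximal_flame_local) (auto simp: optimal_basis_def)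
  fix F' assume F': "maximal_flame G r F'"
  have sub: "F' \<subseteq> arcs G" using F' by (simp add: maximal_flame_def)
  have split: "sum w A = (\<Sum>v \<in> verts G. sum w (into A v))" if "A \<subseteq> arcs G" for A
    using that finite_arc_subset[OF that] by (intro sum.group[symmetric]) auto
  have "sum w (into F v) \<le> sum w (into F' v)" if v: "v \<in> verts G" for v
  proof (cases "v = r")
    case True
    have "0 \<le> sum w (into F' r)" using assms(4) sub by (intro sum_nonneg) auto
    then show ?thesis using True assms(5) by (metis sum.empty)
  next
    case False
    then have v': "v \<in> verts G - {r}" using v by simp
    have "card (into F' v) = card (into F v)"
      using arc_conn_eq_card[OF assms(3) v'] opt[OF v'] maximal_flame_linkable(2)[OF F' v']
      by (simp add: optimal_basis_def)
    then show ?thesis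
      using opt[OF v'] maximal_flame_linkable(1)[OF F' v'] by (simp add: optimal_basis_def)
  qed
  then show "sum w F \<le> sum w F'"
    unfolding split[OF assms(2)] split[OF sub] by (rule sum_mono)
qed

subsection \<open>The greedy invariant\<close>

text \<open>
  \<open>Q\<close> are the arcs considered so far, \<open>B\<close> the accepted ones. The set \<open>W\<close> certifies that no rejected
  arc can be added to \<open>B\<close>. The last clause is the exchange argument in a form that is
  preserved step by step: the missing \<open>|B| - |X \<inter> Q|\<close> arcs of \<open>X\<close> are charged at any price \<open>c\<close> that is at
  least the largest weight seen so far.
\<close>

definition greedy :: "'a \<Rightarrow> ('b \<Rightarrow> rat) \<Rightarrow> 'a \<Rightarrow> 'b set \<Rightarrow> 'b set \<Rightarrow> bool" where
  "greedy r w v Q B \<longleftrightarrow> Q \<subseteq> in_arcs G v \<and> B \<subseteq> Q \<and> linkable r v B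
    \<and> (\<exists>W. v \<in> W \<and> r \<notin> W \<and> card (entering (arcs_via v B) W) \<le> card B \<and> tail G ` (Q - B) \<subseteq> W)
    \<and> (\<forall>q \<in> Q. \<forall>x \<in> in_arcs G v - Q. w q \<le> w x)
    \<and> (\<forall>X c. linkable r v X \<longrightarrow> (\<forall>q \<in> Q. w q \<le> c) \<longrightarrow>
         sum w B \<le> sum w (X \<inter> Q) + of_int (int (card B) - int (card (X \<inter> Q))) * c)"

lemma greedy_empty:
  assumes "r \<noteq> v" shows "greedy r w v {} {}"
proof -
  have "entering (arcs_via v {}) {v} = {}" by (auto simp: entering_def in_arcs_def)
  then show ?thesis
    using assms unfolding greedy_def linkable_def
    by (auto simp: cuts_ge_def intro!: exI[of _ "{v}"])
qed

text \<open>The certificate \<open>W\<close> bounds the rank of \<open>Q\<close> by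
  \<open>card B\<close>. Arcs of \<open>Q - B\<close> start inside \<open>W\<close>, so an arc of
  \<open>arcs_via v X\<close> entering \<open>W\<close> is counted in the cut of \<open>B\<close> or
  lies in \<open>X - Q\<close>. Hence \<open>card X\<close> is at most
  \<open>card B + card (X - Q)\<close>.\<close>

lemma linkable_rank:
  assumes "linkable r v X" "v \<in> W" "r \<notin> W" "card (entering (arcs_via v B) W) \<le> card B"
    and "tail G ` (Q - B) \<subseteq> W"
  shows "card (X \<inter> Q) \<le> card B"
proof -
  have X: "X \<subseteq> in_arcs G v" and finX: "finite X"
    using assms(1) finite_subset[OF _ finite_in_arcs] by (auto simp: linkable_def)
  have "card X \<le> card (entering (arcs_via v X) W)"
    using assms by (auto simp: linkable_def cuts_ge_def)
  also have "\<dots> \<le> card (entering (arcs_via v B) W \<union> (X - Q))"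
  proof (intro card_mono subsetI)
    fix a assume a: "a \<in> entering (arcs_via v X) W"
    show "a \<in> entering (arcs_via v B) W \<union> (X - Q)"
      using a assms(5) by (auto simp: entering_def in_arcs_def)
  qed (use finX in auto)
  also have "\<dots> \<le> card B + card (X - Q)"
    using card_Un_le[of "entering (arcs_via v B) W" "X - Q"] assms(4) by linarith
  finally show ?thesis
    using card_Diff_subset_Int[of X Q] card_mono[OF finX, of "X \<inter> Q"] finX by auto
qed

text \<open>Merges the certificates of earlier rejections with that of a new one, so that a single
  cut covers all rejected arcs.\<close>

lemma linkable_bottleneck_Un:
  assumes "linkable r v B"
    and "v \<in> W" "r \<notin> W" "card (entering (arcs_via v B) W) \<le> card B"
    and "v \<in> W'" "r \<notin> W'" "card (entering (arcs_via v B) W') \<le> card B"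
  shows "card (entering (arcs_via v B) (W \<union> W')) \<le> card B"
proof -
  have "card B \<le> card (entering (arcs_via v B) (W \<inter> W'))"
    using assms by (intro cuts_geD[of _ r v]) (auto simp: linkable_def)
  moreover have "card (entering (arcs_via v B) (W \<inter> W')) + card (entering (arcs_via v B) (W \<union> W'))
      \<le> card (entering (arcs_via v B) W) + card (entering (arcs_via v B) W')"
    by (intro card_entering_submodular) auto
  ultimately show ?thesis using assms by linarith
qed

lemma sum_Int_insert:
  assumes "finite X" "e \<notin> Q"
  shows "sum w (X \<inter> insert e Q) = sum w (X \<inter> Q) + (if e \<in> X then w e else (0::rat))"
    "card (X \<inter> insert e Q) = card (X \<inter> Q) + (if e \<in> X then 1 else 0)"
  using assms by (auto simp: Int_insert_right)

lemma greedy_step: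
  assumes g: "greedy r w v Q B" and e: "e \<in> in_arcs G v - Q"
    and emin: "\<And>x. x \<in> in_arcs G v - Q \<Longrightarrow> w e \<le> w x"
  shows greedy_insert: "linkable r v (insert e B) \<Longrightarrow> greedy r w v (insert e Q) (insert e B)"
    and greedy_skip: "\<lbrakk>v \<in> W'; r \<notin> W'; tail G e \<in> W'; card (entering (arcs_via v B) W') \<le> card B\<rbrakk>
           \<Longrightarrow> greedy r w v (insert e Q) B"
proof -
  have Q: "Q \<subseteq> in_arcs G v" "B \<subseteq> Q" and lB: "linkable r v B"
    and sorted: "\<And>q x. q \<in> Q \<Longrightarrow> x \<in> in_arcs G v - Q \<Longrightarrow> w q \<le> w x"
    and opt: "\<And>X c. linkable r v X \<Longrightarrow> (\<And>q. q \<in> Q \<Longrightarrow> w q \<le> c) \<Longrightarrow>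
         sum w B \<le> sum w (X \<inter> Q) + of_int (int (card B) - int (card (X \<inter> Q))) * c"
    using g by (auto simp: greedy_def)
  obtain W where W: "v \<in> W" "r \<notin> W" "card (entering (arcs_via v B) W) \<le> card B" "tail G ` (Q - B) \<subseteq> W"
    using g by (auto simp: greedy_def)
  have finB: "finite B" and eB: "e \<notin> B"
    using Q e finite_subset[OF _ finite_in_arcs, of B v] by auto
  have finX: "finite X" if "linkable r v X" for X
    using that finite_subset[OF _ finite_in_arcs] by (auto simp: linkable_def)
  have we: "w q \<le> w e" if "q \<in> Q" for q using sorted that e by blast
  have sorted': "\<forall>q \<in> insert e Q. \<forall>x \<in> in_arcs G v - insert e Q. w q \<le> w x"
    using sorted emin by blast
  {
    assume l: "linkable r v (insert e B)"
    have "card (entering (arcs_via v (insert e B)) W) \<le> card (insert e (entering (arcs_via v B) W))"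
      by (intro card_mono) (auto simp: entering_def)
    also have "\<dots> \<le> Suc (card (entering (arcs_via v B) W))" by (rule card_insert_le_m1) auto
    finally have c: "card (entering (arcs_via v (insert e B)) W) \<le> card (insert e B)"
      using W(3) finB eB by simp
    have t: "tail G ` (insert e Q - insert e B) \<subseteq> W" using W(4) e by auto
    have "sum w (insert e B) \<le> sum w (X \<inter> insert e Q)
        + of_int (int (card (insert e B)) - int (card (X \<inter> insert e Q))) * c"
      if X: "linkable r v X" and c': "\<forall>q \<in> insert e Q. w q \<le> c" for X c
    proof -
      \<comment> \<open>The old inequality is used at price \<open>w e\<close>, which dominates all
        earlier weights. Raising the price to \<open>c\<close> is harmless because the rank bound
        makes its coefficient nonnegative.\<close>
      have "card (X \<inter> insert e Q) \<le> card (insert e B)" by (rule linkable_rank[OF X W(1,2) c t])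
      then have "0 \<le> (of_int (int (card (insert e B)) - int (card (X \<inter> insert e Q))) :: rat) * (c - w e)"
        using c' by (intro mult_nonneg_nonneg) auto
      then show ?thesis
        using opt[OF X we] sum_Int_insert[OF finX[OF X], of e Q] e eB finB
        by (auto simp: algebra_simps split: if_splits)
    qed
    with c t W Q e l sorted' show "greedy r w v (insert e Q) (insert e B)"
      unfolding greedy_def by (intro conjI exI[of _ W] allI impI) auto
  }
  {
    assume W': "v \<in> W'" "r \<notin> W'" "tail G e \<in> W'" "card (entering (arcs_via v B) W') \<le> card B"
    have c: "card (entering (arcs_via v B) (W \<union> W')) \<le> card B"
      by (rule linkable_bottleneck_Un[OF lB W(1-3) W'(1,2,4)])
    have t: "tail G ` (insert e Q - B) \<subseteq> W \<union> W'" using W(4) W'(3) by auto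
    have r: "v \<in> W \<union> W'" "r \<notin> W \<union> W'" using W W' by auto
    have "sum w B \<le> sum w (X \<inter> insert e Q)
        + of_int (int (card B) - int (card (X \<inter> insert e Q))) * c"
      if X: "linkable r v X" and c': "\<forall>q \<in> insert e Q. w q \<le> c" for X c
    proof -
      have "card (X \<inter> insert e Q) \<le> card B" by (rule linkable_rank[OF X r c t])
      then have "0 \<le> (of_int (int (card B) - int (card (X \<inter> insert e Q))) :: rat) * (c - w e)"
        using c' by (intro mult_nonneg_nonneg) auto
      then show ?thesis
        using opt[OF X we] sum_Int_insert[OF finX[OF X], of e Q] e
        by (auto simp: algebra_simps split: if_splits)
    qed
    with c t r Q e lB sorted' show "greedy r w v (insert e Q) B"
      unfolding greedy_def by (intro conjI exI[of _ "W \<union> W'"] allI impI) auto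
  }
qed

text \<open>Rejected arcs start inside \<open>W\<close>, so \<open>W\<close> is a cut of the same
  size in the whole digraph. For a competitor of equal size the coefficient of the price
  \<open>c\<close> vanishes.\<close>

lemma greedy_complete:
  assumes "greedy r w v (in_arcs G v) B"
  shows "optimal_basis r w v B"
proof -
  obtain W where W: "v \<in> W" "r \<notin> W" "card (entering (arcs_via v B) W) \<le> card B"
      "tail G ` (in_arcs G v - B) \<subseteq> W"
    using assms by (auto simp: greedy_def)
  have "entering (arcs G) W = entering (arcs_via v B) W"
    using W(4) by (fastforce simp: entering_def)
  then have "saturated r v B" using W by (auto simp: saturated_def)
  moreover have "sum w B \<le> sum w X" if X: "linkable r v X" "card X = card B" for X
  proof -
    have "X \<inter> in_arcs G v = X" using X by (auto simp: linkable_def)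
    moreover have "\<forall>q \<in> in_arcs G v. w q \<le> Max (w ` in_arcs G v)"
      by (intro ballI Max_ge) (auto simp: finite_in_arcs)
    ultimately show ?thesis using assms X unfolding greedy_def
      by (metis add_0_right diff_self mult_zero_left of_int_0)
  qed
  ultimately show ?thesis using assms by (auto simp: optimal_basis_def greedy_def)
qed

lemma flow_imp_linkable:
  assumes "flow r v f" "outof f v = {}"
  shows "linkable r v (into f v)"
  unfolding linkable_def cuts_ge_def
proof (intro conjI allI impI)
  have f: "f \<subseteq> arcs G" using assms by (simp add: flow_def)
  then show "into f v \<subseteq> in_arcs G v" by (auto simp: in_arcs_def)
  fix W assume W: "v \<in> W" "r \<notin> W"
  have "card (outof f v) = 0" using assms(2) by (simp only: card.empty)
  then have "card (into f v) \<le> card (entering f W)"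
    using flow_cut[OF assms(1) W] by simp
  also have "\<dots> \<le> card (entering (arcs_via v (into f v)) W)"
    using f by (intro card_mono entering_mono) (auto simp: in_arcs_def)
  finally show "card (into f v) \<le> card (entering (arcs_via v (into f v)) W)" .
qed

text \<open>Every arc of \<open>arcs_via v (into f v)\<close> leaving \<open>R\<close> carries flow,
  and no flow returns to \<open>R\<close>. Thus the cut around \<open>- R\<close> is no larger than
  the flow value. The search never expands \<open>v\<close>, hence the exceptions for it.\<close>

lemma residual_unreachable_cut:
  assumes "flow r v f" "outof f v = {}" "r \<in> R" "v \<notin> R"
    and fwd: "\<And>a. a \<in> arcs G \<Longrightarrow> a \<notin> f \<Longrightarrow> tail G a \<in> R \<Longrightarrow> head G a \<in> R \<or> head G a = v"
    and bwd: "\<And>a. a \<in> f \<Longrightarrow> head G a \<in> R \<Longrightarrow> tail G a \<in> R \<or> tail G a = v"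
  shows "card (entering (arcs_via v (into f v)) (- R)) \<le> card (into f v)"
proof -
  have f: "f \<subseteq> arcs G" using assms by (simp add: flow_def)
  have "card (entering (arcs_via v (into f v)) (- R)) \<le> card (entering f (- R))"
    using fwd finite_arc_subset[OF f] by (intro card_mono) (auto simp: entering_def in_arcs_def)
  moreover have "entering f (- (- R)) = {}" using bwd assms(2) by (auto simp: entering_def)
  ultimately show ?thesis using flow_cut[OF assms(1), of "- R"] assms(3,4) by simp
qed

end

section \<open>Time-bounded total correctness\<close>

definition run :: "com \<Rightarrow> state \<Rightarrow> nat \<Rightarrow> (state \<Rightarrow> bool) \<Rightarrow> bool" where
  "run c s k Q \<longleftrightarrow> (\<exists>t s'. exec c s t s' \<and> t \<le> k \<and> Q s')"

fun written_regs :: "com \<Rightarrow> nat set" where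
  "written_regs SKIP = {}"
| "written_regs (Const x k) = {x}"
| "written_regs (Copy x y) = {x}"
| "written_regs (Inc x) = {x}"
| "written_regs (Dec x) = {x}"
| "written_regs (Load x a y) = {x}"
| "written_regs (Store a x y) = {}"
| "written_regs (Seq c1 c2) = written_regs c1 \<union> written_regs c2"
| "written_regs (IF b c1 c2) = written_regs c1 \<union> written_regs c2"
| "written_regs (WHILE b c) = written_regs c"

fun written_mems :: "com \<Rightarrow> nat set" where
  "written_mems (Store a x y) = {a}"
| "written_mems (Seq c1 c2) = written_mems c1 \<union> written_mems c2"
| "written_mems (IF b c1 c2) = written_mems c1 \<union> written_mems c2"
| "written_mems (WHILE b c) = written_mems c"
| "written_mems _ = {}"

text \<open>A syntactic frame condition: loop invariants need to mention only what the loop body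
  writes.\<close>

definition unchanged :: "com \<Rightarrow> state \<Rightarrow> state \<Rightarrow> bool" where
  "unchanged c s s' \<longleftrightarrow> (\<forall>x. x \<notin> written_regs c \<longrightarrow> reg s' x = reg s x)
     \<and> (\<forall>a. a \<notin> written_mems c \<longrightarrow> mem s' a = mem s a) \<and> wt s' = wt s"

lemma unchanged_refl: "unchanged c s s"
  by (simp add: unchanged_def)

lemma unchanged_trans: "unchanged c s s' \<Longrightarrow> unchanged c s' s'' \<Longrightarrow> unchanged c s s''"
  by (simp add: unchanged_def)

lemma exec_unchanged: "exec c s t s' \<Longrightarrow> unchanged c s s'"
  by (induction rule: exec.induct) (auto simp: unchanged_def set_reg_def set_mem_def)

lemma run_weaken:
  assumes "run c s k P" "k \<le> k'" "\<And>s'. unchanged c s s' \<Longrightarrow> P s' \<Longrightarrow> Q s'"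
  shows "run c s k' Q"
  using assms exec_unchanged unfolding run_def by (meson order_trans)

lemma run_Seq:
  assumes "run c1 s k1 P" "\<And>s'. unchanged c1 s s' \<Longrightarrow> P s' \<Longrightarrow> run c2 s' k2 Q" "k1 + k2 \<le> k"
  shows "run (Seq c1 c2) s k Q"
proof -
  obtain t1 s' where 1: "exec c1 s t1 s'" "t1 \<le> k1" "P s'" using assms(1) by (auto simp: run_def)
  then obtain t2 s'' where "exec c2 s' t2 s''" "t2 \<le> k2" "Q s''"
    using assms(2)[OF exec_unchanged[OF 1(1)]] by (auto simp: run_def)
  with 1 assms(3) exec_Seq show ?thesis unfolding run_def by (metis add_mono order_trans)
qed

lemma run_IF:
  assumes "holds b s \<Longrightarrow> run c1 s k Q" "\<not> holds b s \<Longrightarrow> run c2 s k Q"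
  shows "run (IF b c1 c2) s (Suc k) Q"
proof (cases "holds b s")
  case True
  with assms(1) obtain t s' where "exec c1 s t s'" "t \<le> k" "Q s'" by (auto simp: run_def)
  with True exec_IF_True show ?thesis unfolding run_def
    by (metis Suc_le_mono plus_1_eq_Suc)
next
  case False
  with assms(2) obtain t s' where "exec c2 s t s'" "t \<le> k" "Q s'" by (auto simp: run_def)
  with False exec_IF_False show ?thesis unfolding run_def
    by (metis Suc_le_mono plus_1_eq_Suc)
qed

text \<open>Amortised bound: an iteration may cost any \<open>k\<close> covered by the drop of the
  potential. Strictness of the drop pays for the loop test, and the outer \<open>Suc\<close> for the
  final failing one.\<close>

lemma run_WHILE_potential:
  assumes "I s"
    and "\<And>s'. unchanged c s s' \<Longrightarrow> I s' \<Longrightarrow> holds b s' \<Longrightarrow>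
           \<exists>k. run c s' k (\<lambda>s''. I s'' \<and> \<Phi> s'' + k < \<Phi> s')"
  shows "run (WHILE b c) s (Suc (\<Phi> s)) (\<lambda>s'. I s' \<and> \<not> holds b s')"
proof -
  have "run (WHILE b c) s' (Suc (\<Phi> s')) (\<lambda>s'. I s' \<and> \<not> holds b s')"
    if "unchanged c s s'" "I s'" for s'
    using that
  proof (induction "\<Phi> s'" arbitrary: s' rule: less_induct)
    case less
    show ?case
    proof (cases "holds b s'")
      case True
      then obtain k t s'' where t: "exec c s' t s''" "t \<le> k" "I s''" "\<Phi> s'' + k < \<Phi> s'"
        using assms(2) less.prems unfolding run_def by blast
      then obtain t2 s3 where t2: "exec (WHILE b c) s'' t2 s3" "t2 \<le> Suc (\<Phi> s'')" "I s3" "\<not> holds b s3"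
        using less.hyps[of s''] unchanged_trans[OF less.prems(1) exec_unchanged[OF t(1)]]
        unfolding run_def by fastforce
      have "exec (WHILE b c) s' (1 + t + t2) s3"
        using True t(1) t2(1) by (rule exec_WHILE_True)
      then show ?thesis unfolding run_def using t t2 by (intro exI[of _ "1 + t + t2"] exI[of _ s3]) auto
    next
      case False
      then show ?thesis unfolding run_def using less.prems exec_WHILE_False[OF False]
        by (intro exI[of _ 1] exI[of _ s']) auto
    qed
  qed
  then show ?thesis using assms(1) unchanged_refl by blast
qed

lemma run_WHILE:
  fixes \<mu> :: "state \<Rightarrow> nat"
  assumes "I s"
    and "\<And>s'. unchanged c s s' \<Longrightarrow> I s' \<Longrightarrow> holds b s' \<Longrightarrow> run c s' k (\<lambda>s''. I s'' \<and> \<mu> s'' < \<mu> s')"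
    and "Suc (\<mu> s * Suc k) \<le> k'"
  shows "run (WHILE b c) s k' (\<lambda>s'. I s' \<and> \<not> holds b s')"
proof -
  \<comment> \<open>The copy \<open>k'\<close> names the outer \<open>k\<close> under the quantifier
    that rebinds it.\<close>
  have "\<exists>k. run c s' k (\<lambda>s''. I s'' \<and> \<mu> s'' * Suc k' + k < \<mu> s' * Suc k')"
    if k': "k' = k" and "unchanged c s s'" "I s'" "holds b s'" for s' k'
  proof -
    have "run c s' k (\<lambda>s''. I s'' \<and> \<mu> s'' * Suc k' + k < \<mu> s' * Suc k')"
    proof (rule run_weaken[OF assms(2)[OF that(2-4)] order_refl])
      fix s'' assume "I s'' \<and> \<mu> s'' < \<mu> s'"
      then have "Suc (\<mu> s'') * Suc k \<le> \<mu> s' * Suc k" by (intro mult_right_mono) auto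
      then show "I s'' \<and> \<mu> s'' * Suc k' + k < \<mu> s' * Suc k'"
        using \<open>I s'' \<and> _\<close> unfolding k' mult_Suc by linarith
    qed
    then show ?thesis by blast
  qed
  from run_WHILE_potential[of I s c b "\<lambda>s. \<mu> s * Suc k", OF assms(1) this[OF refl]]
  show ?thesis by (rule run_weaken) (use assms(3) in auto)
qed

fun loop_free :: "com \<Rightarrow> bool" where
  "loop_free (WHILE b c) = False"
| "loop_free (Seq c1 c2) = (loop_free c1 \<and> loop_free c2)"
| "loop_free (IF b c1 c2) = (loop_free c1 \<and> loop_free c2)"
| "loop_free _ = True"

fun steps :: "com \<Rightarrow> nat" where
  "steps (Seq c1 c2) = steps c1 + steps c2"
| "steps (IF b c1 c2) = Suc (max (steps c1) (steps c2))"
| "steps _ = 1"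

text \<open>Straight-line code is evaluated by the simplifier through this function. Its value on
  loops is a dummy, excluded by \<open>loop_free\<close> in \<open>run_loop_free\<close>.\<close>

fun sem :: "com \<Rightarrow> state \<Rightarrow> state" where
  "sem (Const x k) s = set_reg x k s"
| "sem (Copy x y) s = set_reg x (reg s y) s"
| "sem (Inc x) s = set_reg x (reg s x + 1) s"
| "sem (Dec x) s = set_reg x (reg s x - 1) s"
| "sem (Load x a y) s = set_reg x (mem s a (reg s y)) s"
| "sem (Store a x y) s = set_mem a (reg s x) (reg s y) s"
| "sem (Seq c1 c2) s = sem c2 (sem c1 s)"
| "sem (IF b c1 c2) s = (if holds b s then sem c1 s else sem c2 s)"
| "sem _ s = s"

lemma run_loop_free:
  assumes "loop_free c" "steps c \<le> k" "Q (sem c s)"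
  shows "run c s k Q"
proof -
  have "\<exists>t. exec c s t (sem c s) \<and> t \<le> steps c"
    using assms(1)
  proof (induction c arbitrary: s)
    case (Seq c1 c2)
    then obtain t1 t2 where "exec c1 s t1 (sem c1 s)" "t1 \<le> steps c1"
        "exec c2 (sem c1 s) t2 (sem c2 (sem c1 s))" "t2 \<le> steps c2"
      by fastforce
    then show ?case by (auto intro!: exec_Seq add_mono)
  next
    case (IF b c1 c2)
    show ?case
    proof (cases "holds b s")
      case True
      with IF obtain t where "exec c1 s t (sem c1 s)" "t \<le> steps c1" by fastforce
      with True show ?thesis by (intro exI[of _ "1 + t"]) (auto intro: exec_IF_True[of _ _ _ t, simplified])
    next
      case False
      with IF obtain t where "exec c2 s t (sem c2 s)" "t \<le> steps c2" by fastforce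
      with False show ?thesis by (intro exI[of _ "1 + t"]) (auto intro: exec_IF_False[of _ _ _ t, simplified])
    qed
  qed (auto intro: exec.intros[simplified])
  then show ?thesis using assms(2,3) order_trans unfolding run_def by blast
qed

section \<open>The program\<close>

notation Seq (infixr \<open>;;\<close> 60)

abbreviation (input) "rM \<equiv> Suc 0"
abbreviation (input) "rRoot \<equiv> 2 :: nat"
abbreviation (input) "rZero \<equiv> 3 :: nat"
abbreviation (input) "rMM \<equiv> 4 :: nat"
abbreviation (input) "rI \<equiv> 5 :: nat"
abbreviation (input) "rOne \<equiv> 6 :: nat"
abbreviation (input) "rV \<equiv> 7 :: nat"
abbreviation (input) "rJ \<equiv> 8 :: nat"
abbreviation (input) "rGo \<equiv> 9 :: nat"
abbreviation (input) "rE \<equiv> 10 :: nat"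
abbreviation (input) "rD \<equiv> 11 :: nat"
abbreviation (input) "rQh \<equiv> 12 :: nat"
abbreviation (input) "rQt \<equiv> 13 :: nat"
abbreviation (input) "rX \<equiv> 14 :: nat"
abbreviation (input) "rY \<equiv> 15 :: nat"
abbreviation (input) "rP \<equiv> 16 :: nat"

text \<open>
  Every arc \<open>a\<close> yields two darts, \<open>a + 1\<close> from tail to head and \<open>m + a + 1\<close> from head to tail,
  so that 0 can serve as the null dart; \<open>aOpp\<close> maps one to the other. The darts with a common source form
  a linked list given by \<open>aFirst\<close> and \<open>aNext\<close>, in decreasing order. An entry of \<open>aCap\<close> is 1 for the
  residual darts and 0 for the others, so the arc \<open>a\<close> carries flow iff the capacity of dart \<open>a + 1\<close>
  is 0. A visited vertex is marked in \<open>aVis\<close> by the dart through which it was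
  discovered (the marks 1 of \<open>r\<close> and of the forbidden vertex \<open>v\<close> are never used as darts), and
  \<open>aQueue\<close> contains all visited vertices but \<open>v\<close> in the order of discovery.
\<close>

abbreviation (input) "aTail \<equiv> 0 :: nat"
abbreviation (input) "aHead \<equiv> Suc 0"
abbreviation (input) "aOut \<equiv> 2 :: nat"
abbreviation (input) "aSrc \<equiv> 3 :: nat"
abbreviation (input) "aDst \<equiv> 4 :: nat"
abbreviation (input) "aOpp \<equiv> 5 :: nat"
abbreviation (input) "aFirst \<equiv> 6 :: nat"
abbreviation (input) "aNext \<equiv> 7 :: nat"
abbreviation (input) "aCap \<equiv> 8 :: nat"
abbreviation (input) "aVis \<equiv> 9 :: nat"
abbreviation (input) "aQueue \<equiv> 10 :: nat"
abbreviation (input) "aDone \<equiv> 11 :: nat"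

definition make_darts :: com where
  "make_darts = WHILE (Less rI rM)
     (Load rX aTail rI ;; Load rY aHead rI ;; Inc rI ;; Inc rMM ;;
      Store aSrc rI rX ;; Store aDst rI rY ;; Store aOpp rI rMM ;;
      Store aSrc rMM rY ;; Store aDst rMM rX ;; Store aOpp rMM rI)"

definition link_darts :: com where
  "link_darts = WHILE (Less rD rMM)
     (Inc rD ;; Load rX aSrc rD ;; Load rY aFirst rX ;; Store aNext rD rY ;; Store aFirst rX rD)"

definition preprocess :: com where
  "preprocess = Const rOne 1 ;; Copy rMM rM ;; make_darts ;; link_darts"

definition select_step :: com where
  "select_step = Load rX aHead rI ;; Load rP aDone rI ;;
     IF (Eq rX rV)
       (IF (Eq rP rZero)
          (IF (Less rZero rGo)
             (IF (WLess rI rE) (Copy rE rI) SKIP)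
             (Copy rE rI ;; Const rGo 1))
          SKIP)
       SKIP ;;
     Inc rI"

definition select :: com where
  "select = Const rGo 0 ;; Const rI 0 ;;
     WHILE (Less rI rM) select_step"

definition clear_visited :: com where
  "clear_visited = Const rD 0 ;;
     WHILE (Less rD rMM) (Inc rD ;; Load rY aDst rD ;; Store aVis rY rZero)"

definition search_step :: com where
  "search_step =
     IF (Less rZero rD)
       (Load rP aCap rD ;;
        IF (Less rZero rP)
          (Load rY aDst rD ;; Load rP aVis rY ;;
           IF (Eq rP rZero)
             (Store aVis rY rD ;; Store aQueue rQt rY ;; Inc rQt)
             SKIP)
          SKIP ;;
        Load rD aNext rD)
       (Inc rQh ;; Load rX aQueue rQh ;; Load rD aFirst rX)"

definition init_queue :: com where
  "init_queue = Store aVis rRoot rOne ;; Store aVis rV rOne ;;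
     Const rQh 0 ;; Const rQt 0 ;; Store aQueue rQt rRoot ;; Inc rQt ;; Load rD aFirst rRoot"

definition search :: com where
  "search = clear_visited ;; init_queue ;; WHILE (Less rQh rQt) search_step"

text \<open>After reversing the dart in \<open>rD\<close>, the walk moves on to the dart that
  discovered its source; iteration climbs the search tree.\<close>

definition flip :: com where
  "flip = Load rP aOpp rD ;; Store aCap rD rZero ;; Store aCap rP rOne ;;
     Load rX aSrc rD ;; Load rD aVis rX"

text \<open>Resetting the mark of the root to the null dart makes it the sentinel that stops the
  climb.\<close>

definition augment :: com where
  "augment = (Store aOut rE rOne ;; Store aVis rRoot rZero ;; Copy rD rE ;; Inc rD ;; flip) ;;
     WHILE (Less rZero rD) flip"

definition clear_flow :: com where
  "clear_flow = Const rI 0 ;; Copy rP rM ;;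
     WHILE (Less rI rM) (Inc rI ;; Inc rP ;; Store aCap rI rOne ;; Store aCap rP rZero)"

definition try_arc :: com where
  "try_arc = Store aDone rE rOne ;; search ;; Load rX aTail rE ;; Load rP aVis rX ;;
     IF (Less rZero rP) augment SKIP"

definition process_vertex :: com where
  "process_vertex = clear_flow ;; Const rGo 1 ;;
     WHILE (Less rZero rGo) (select ;; IF (Less rZero rGo) try_arc SKIP)"

text \<open>A vertex is processed when its first unexamined incoming arc is met;
  \<open>aDone\<close> thus doubles as the record of processed heads.\<close>

definition flame_program :: com where
  "flame_program = preprocess ;;
     WHILE (Less rJ rM)
      (Load rV aHead rJ ;; Load rP aDone rJ ;;
       IF (Eq rP rZero) (IF (Eq rV rRoot) SKIP process_vertex) SKIP ;;
       Inc rJ)"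

lemma run_sem_Seq:
  assumes "run c2 (sem c1 s) k2 Q" "loop_free c1" "steps c1 + k2 \<le> k"
  shows "run (c1 ;; c2) s k Q"
  using assms by (intro run_Seq[of c1 s "steps c1" "\<lambda>s'. s' = sem c1 s"]) (auto intro: run_loop_free)

lemma state_updates [simp]:
  "reg (set_reg x k s) = (reg s)(x := k)" "mem (set_reg x k s) = mem s" "wt (set_reg x k s) = wt s"
  "reg (set_mem a i k s) = reg s" "mem (set_mem a i k s) = (mem s)(a := (mem s a)(i := k))"
  "wt (set_mem a i k s) = wt s"
  by (simp_all add: set_reg_def set_mem_def)

locale flame_input = fin_digraph G for G :: "(nat, nat) pre_digraph" (structure) +
  fixes n m r :: nat and w :: "nat \<Rightarrow> rat"
  assumes verts_eq: "verts G = {..<n}" and arcs_eq: "arcs G = {..<m}"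
    and root: "r \<in> verts G" and acyclic: "acyclic_digraph G"
    and nonneg: "\<forall>e \<in> arcs G. 0 \<le> w e"
begin

section \<open>Darts, their linked lists and the preprocessing\<close>

definition dsrc :: "nat \<Rightarrow> nat" where
  "dsrc d = (if d \<le> m then tail G (d - 1) else head G (d - 1 - m))"

definition ddst :: "nat \<Rightarrow> nat" where
  "ddst d = (if d \<le> m then head G (d - 1) else tail G (d - 1 - m))"

definition dopp :: "nat \<Rightarrow> nat" where
  "dopp d = (if d \<le> m then d + m else d - m)"

abbreviation darts :: "nat set" where
  "darts \<equiv> {1..2 * m}"

text \<open>Describes the linked lists without list induction: \<open>aFirst\<close> is the largest
  dart of a source, \<open>aNext\<close> the largest below a given one, and 0 means none.\<close>

definition last_dart :: "nat \<Rightarrow> nat \<Rightarrow> nat \<Rightarrow> bool" where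
  "last_dart u b d \<longleftrightarrow> (d = 0 \<or> d \<in> {1..b} \<and> dsrc d = u) \<and> (\<forall>d' \<in> {d<..b}. dsrc d' \<noteq> u)"

definition input_ok :: "state \<Rightarrow> bool" where
  "input_ok s \<longleftrightarrow> reg s rM = m \<and> reg s rRoot = r \<and> reg s rZero = 0 \<and>
     (\<forall>a<m. mem s aTail a = tail G a \<and> mem s aHead a = head G a \<and> wt s a = w a)"

definition darts_ok :: "state \<Rightarrow> bool" where
  "darts_ok s \<longleftrightarrow> reg s rMM = 2 * m \<and> reg s rOne = 1 \<and>
     (\<forall>d \<in> darts. mem s aSrc d = dsrc d \<and> mem s aDst d = ddst d \<and> mem s aOpp d = dopp d)"

definition links_ok :: "state \<Rightarrow> bool" where
  "links_ok s \<longleftrightarrow> (\<forall>u. last_dart u (2 * m) (mem s aFirst u)) \<and>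
     (\<forall>d \<in> darts. last_dart (dsrc d) (d - 1) (mem s aNext d))"

definition static :: "state \<Rightarrow> bool" where
  "static s \<longleftrightarrow> input_ok s \<and> darts_ok s \<and> links_ok s"

lemma static_unchanged:
  assumes "static s" "unchanged c s s'" "written_regs c \<inter> {rM, rRoot, rZero, rMM, rOne} = {}"
    and "written_mems c \<inter> {aTail, aHead, aSrc, aDst, aOpp, aFirst, aNext} = {}"
  shows "static s'"
proof -
  have "reg s' x = reg s x" if "x \<in> {rM, rRoot, rZero, rMM, rOne}" for x
    using assms(2,3) that unfolding unchanged_def by blast
  moreover have "mem s' a = mem s a" if "a \<in> {aTail, aHead, aSrc, aDst, aOpp, aFirst, aNext}" for a
    using assms(2,4) that unfolding unchanged_def by blast
  moreover have "wt s' = wt s" using assms(2) by (simp add: unchanged_def)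
  ultimately show ?thesis
    using assms(1) by (simp add: static_def input_ok_def darts_ok_def links_ok_def)
qed

lemma last_dart_Suc:
  assumes "last_dart u b d"
  shows "last_dart u (Suc b) (if u = dsrc (Suc b) then Suc b else d)"
proof -
  have "{d<..Suc b} \<subseteq> insert (Suc b) {d<..b}" by auto
  then show ?thesis using assms by (auto simp: last_dart_def)
qed

lemma ok_set_reg [simp]:
  "x \<notin> {rM, rRoot, rZero} \<Longrightarrow> input_ok (set_reg x k s) \<longleftrightarrow> input_ok s"
  "x \<notin> {rMM, rOne} \<Longrightarrow> darts_ok (set_reg x k s) \<longleftrightarrow> darts_ok s"
  "links_ok (set_reg x k s) \<longleftrightarrow> links_ok s"
  "x \<notin> {rM, rRoot, rZero, rMM, rOne} \<Longrightarrow> static (set_reg x k s) \<longleftrightarrow> static s"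
  by (auto simp: static_def input_ok_def darts_ok_def links_ok_def)

lemma ok_set_mem [simp]:
  "a \<notin> {aTail, aHead} \<Longrightarrow> input_ok (set_mem a i k s) \<longleftrightarrow> input_ok s"
  "a \<notin> {aSrc, aDst, aOpp} \<Longrightarrow> darts_ok (set_mem a i k s) \<longleftrightarrow> darts_ok s"
  "a \<notin> {aFirst, aNext} \<Longrightarrow> links_ok (set_mem a i k s) \<longleftrightarrow> links_ok s"
  "a \<notin> {aTail, aHead, aSrc, aDst, aOpp, aFirst, aNext} \<Longrightarrow> static (set_mem a i k s) \<longleftrightarrow> static s"
  by (auto simp: static_def input_ok_def darts_ok_def links_ok_def)

lemma input_okD:
  assumes "input_ok s"
  shows "reg s rM = m" "reg s rRoot = r" "reg s rZero = 0"
    "\<And>a. a < m \<Longrightarrow> mem s aTail a = tail G a" "\<And>a. a < m \<Longrightarrow> mem s aHead a = head G a"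
    "\<And>a. a < m \<Longrightarrow> wt s a = w a"
  using assms by (auto simp: input_ok_def)

lemma darts_okD:
  assumes "darts_ok s"
  shows "reg s rMM = 2 * m" "reg s rOne = 1"
    "\<And>d. d \<in> darts \<Longrightarrow> mem s aSrc d = dsrc d" "\<And>d. d \<in> darts \<Longrightarrow> mem s aDst d = ddst d"
    "\<And>d. d \<in> darts \<Longrightarrow> mem s aOpp d = dopp d"
  using assms by (auto simp: darts_ok_def)

lemma initial_input_ok: "input_ok (initial_state G r w)"
  by (auto simp: input_ok_def initial_state_def arcs_eq)

lemma run_preprocess:
  assumes "s = initial_state G r w"
  shows "run preprocess s (40 * m + 10) static"
proof -
  have i: "input_ok s" using initial_input_ok assms by simp
  define J where "J s \<longleftrightarrow> input_ok s \<and> reg s rOne = 1 \<and> reg s rI \<le> m \<and> reg s rMM = m + reg s rI \<and>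
     (\<forall>d. d \<in> {1..reg s rI} \<or> d \<in> {m + 1..m + reg s rI} \<longrightarrow>
        mem s aSrc d = dsrc d \<and> mem s aDst d = ddst d \<and> mem s aOpp d = dopp d)" for s
  define K where "K s \<longleftrightarrow> input_ok s \<and> darts_ok s \<and> reg s rD \<le> 2 * m \<and>
     (\<forall>u. last_dart u (reg s rD) (mem s aFirst u)) \<and>
     (\<forall>d \<in> {1..reg s rD}. last_dart (dsrc d) (d - 1) (mem s aNext d))" for s
  \<comment> \<open>Ten instructions and one test per arc, and a final test; bounds of the later
    loops arise in the same way.\<close>
  have m1: "run make_darts s1 (11 * m + 1) (\<lambda>s'. J s' \<and> \<not> holds (Less rI rM) s')" if "J s1" "reg s1 rI = 0" for s1
    unfolding make_darts_def
  proof (rule run_WHILE[where \<mu> = "\<lambda>s. reg s rM - reg s rI" and k = 10])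
    fix s' assume "J s'" "holds (Less rI rM) s'"
    then show "run (Load rX aTail rI ;; Load rY aHead rI ;; Inc rI ;; Inc rMM ;;
      Store aSrc rI rX ;; Store aDst rI rY ;; Store aOpp rI rMM ;;
      Store aSrc rMM rY ;; Store aDst rMM rX ;; Store aOpp rMM rI) s' 10
      (\<lambda>s''. J s'' \<and> reg s'' rM - reg s'' rI < reg s' rM - reg s' rI)"
      by (intro run_loop_free)
         (auto simp: J_def input_ok_def dsrc_def ddst_def dopp_def le_Suc_eq)
  qed (use that in \<open>auto simp: J_def input_ok_def\<close>)
  have m2: "run link_darts s1 (12 * m + 1) (\<lambda>s'. K s' \<and> \<not> holds (Less rD rMM) s')" if "K s1" "reg s1 rD = 0" for s1
    unfolding link_darts_def
  proof (rule run_WHILE[where \<mu> = "\<lambda>s. reg s rMM - reg s rD" and k = 5])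
    fix s' assume *: "K s'" "holds (Less rD rMM) s'"
    have ok: "input_ok s'" "darts_ok s'" using *(1) by (auto simp: K_def)
    note [simp] = darts_okD[OF ok(2)] input_okD[OF ok(1)]
    have step: "last_dart u (Suc (reg s' rD)) (if u = dsrc (Suc (reg s' rD)) then Suc (reg s' rD) else mem s' aFirst u)" for u
      using *(1) by (intro last_dart_Suc) (simp add: K_def)
    have src: "mem s' aSrc (Suc (reg s' rD)) = dsrc (Suc (reg s' rD))"
      using *(2) by (intro darts_okD[OF ok(2)]) auto
    show "run (Inc rD ;; Load rX aSrc rD ;; Load rY aFirst rX ;; Store aNext rD rY ;; Store aFirst rX rD)
       s' 5 (\<lambda>s''. K s'' \<and> reg s'' rMM - reg s'' rD < reg s' rMM - reg s' rD)"
      using * step src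
      by (intro run_loop_free) (auto simp: K_def le_Suc_eq)
  qed (use that in \<open>auto simp: K_def darts_ok_def\<close>)
  have "J (sem (Copy rMM rM) (sem (Const rOne 1) s))"
    using i by (auto simp: J_def input_ok_def assms initial_state_def)
  then have 1: "run make_darts (sem (Copy rMM rM) (sem (Const rOne 1) s)) (11 * m + 1) (\<lambda>s'. J s' \<and> \<not> holds (Less rI rM) s')"
    by (rule m1) (simp add: assms initial_state_def)
  show ?thesis
    unfolding preprocess_def
  proof (intro run_sem_Seq[OF run_sem_Seq[OF run_Seq[OF 1]]])
    fix s' assume u: "unchanged make_darts (sem (Copy rMM rM) (sem (Const rOne 1) s)) s'"
      and J: "J s' \<and> \<not> holds (Less rI rM) s'"
    have 2: "reg s' rD = 0" "mem s' aFirst = (\<lambda>_. 0)"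
      using u by (auto simp: unchanged_def make_darts_def assms initial_state_def)
    have 3: "reg s' rI = m" using J by (auto simp: J_def input_ok_def)
    have "darts_ok s'"
      unfolding darts_ok_def
    proof (intro conjI ballI)
      fix d assume "d \<in> darts"
      then have "d \<in> {1..m} \<or> d \<in> {m + 1..m + m}" by auto
      with J 3 show "mem s' aSrc d = dsrc d" "mem s' aDst d = ddst d" "mem s' aOpp d = dopp d"
        unfolding J_def by auto
    qed (use J 3 in \<open>auto simp: J_def\<close>)
    then have "K s'" using J 2 by (auto simp: K_def J_def last_dart_def)
    from m2[OF this 2(1)] show "run link_darts s' (12 * m + 1) static"
    proof (rule run_weaken)
      fix s'' assume *: "K s'' \<and> \<not> holds (Less rD rMM) s''"
      then have "reg s'' rMM = 2 * m" by (simp add: K_def darts_ok_def)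
      with * have "reg s'' rD = 2 * m" by (simp add: K_def)
      with * show "static s''" by (simp add: K_def static_def links_ok_def)
    qed simp
  qed auto
qed

subsection \<open>Searching the residual digraph\<close>

lemma staticD:
  assumes "static s"
  shows "reg s rM = m" "reg s rRoot = r" "reg s rZero = 0" "reg s rMM = 2 * m" "reg s rOne = 1"
    "\<And>a. a < m \<Longrightarrow> mem s aTail a = tail G a" "\<And>a. a < m \<Longrightarrow> mem s aHead a = head G a"
    "\<And>a. a < m \<Longrightarrow> wt s a = w a"
    "\<And>d. d \<in> darts \<Longrightarrow> mem s aSrc d = dsrc d" "\<And>d. d \<in> darts \<Longrightarrow> mem s aDst d = ddst d"
    "\<And>d. d \<in> darts \<Longrightarrow> mem s aOpp d = dopp d"
    "\<And>u. last_dart u (2 * m) (mem s aFirst u)"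
    "\<And>d. d \<in> darts \<Longrightarrow> last_dart (dsrc d) (d - 1) (mem s aNext d)"
  using assms unfolding static_def input_ok_def darts_ok_def links_ok_def by blast+

lemma run_select:
  assumes s: "static s"
  defines "C \<equiv> {a. a < m \<and> head G a = reg s rV \<and> mem s aDone a = 0}"
  shows "run select s (11 * m + 3) (\<lambda>s'. if reg s' rGo = 0 then C = {}
           else reg s' rE \<in> C \<and> (\<forall>a \<in> C. w (reg s' rE) \<le> w a))"
proof -
  define I where "I s' \<longleftrightarrow> static s' \<and> reg s' rV = reg s rV \<and> mem s' aDone = mem s aDone \<and> reg s' rI \<le> m \<and>
     (if reg s' rGo = 0 then C \<inter> {..<reg s' rI} = {}
      else reg s' rE \<in> C \<and> (\<forall>a \<in> C \<inter> {..<reg s' rI}. w (reg s' rE) \<le> w a))" for s'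
  let ?s = "sem (Const rI 0) (sem (Const rGo 0) s)"
  have "I ?s" using s by (simp add: I_def)
  then have "run (WHILE (Less rI rM) select_step) ?s (11 * m + 1) (\<lambda>s'. I s' \<and> \<not> holds (Less rI rM) s')"
  proof (rule run_WHILE[where k = 10 and \<mu> = "\<lambda>s. m - reg s rI"])
    fix s' assume *: "I s'" "holds (Less rI rM) s'"
    then have s': "static s'" by (simp add: I_def)
    note [simp] = staticD(1-8)[OF s']
    have lt: "reg s' rI < m" using * by simp
    have C: "reg s' rI \<in> C \<longleftrightarrow> head G (reg s' rI) = reg s' rV \<and> mem s' aDone (reg s' rI) = 0"
      using * lt by (simp add: C_def I_def)
    have E: "reg s' rGo \<noteq> 0 \<Longrightarrow> reg s' rE \<in> C \<and> reg s' rE < m" using * by (simp add: I_def C_def split: if_splits)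
    have less: "w (reg s' rI) \<le> w a"
      if "reg s' rGo \<noteq> 0" "w (reg s' rI) < w (reg s' rE)" "a \<in> C" "a < reg s' rI" for a
      using * that by (auto simp: I_def intro: order.trans[OF less_imp_le])
    have ins: "C \<inter> {..<Suc (reg s' rI)} = (if reg s' rI \<in> C then insert (reg s' rI) (C \<inter> {..<reg s' rI}) else C \<inter> {..<reg s' rI})"
      by (auto simp: less_Suc_eq)
    show "run select_step s' 10 (\<lambda>s''. I s'' \<and> m - reg s'' rI < m - reg s' rI)"
    proof (rule run_loop_free)
      show "I (sem select_step s') \<and> m - reg (sem select_step s') rI < m - reg s' rI"
        using * lt C E s' less by (auto simp: I_def select_step_def ins not_less split: if_splits)
    qed (simp_all add: select_step_def)
  qed (use s in \<open>auto simp: staticD\<close>)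
  then show ?thesis unfolding select_def
  proof (intro run_sem_Seq[OF run_sem_Seq[OF run_weaken]])
    fix s' assume *: "I s' \<and> \<not> holds (Less rI rM) s'"
    then have "static s'" by (simp add: I_def)
    with * have "C \<inter> {..<reg s' rI} = C" by (auto simp: C_def staticD(1) I_def)
    moreover have "if reg s' rGo = 0 then C \<inter> {..<reg s' rI} = {}
        else reg s' rE \<in> C \<and> (\<forall>a \<in> C \<inter> {..<reg s' rI}. w (reg s' rE) \<le> w a)"
      using * unfolding I_def by blast
    ultimately show "if reg s' rGo = 0 then C = {}
           else reg s' rE \<in> C \<and> (\<forall>a \<in> C. w (reg s' rE) \<le> w a)"
      by (simp only:)
  qed auto
qed

lemma run_clear_visited:
  assumes s: "static s"
  shows "run clear_visited s (8 * m + 2) (\<lambda>s'. \<forall>d \<in> darts. mem s' aVis (ddst d) = 0)"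
proof -
  define I where "I s' \<longleftrightarrow> static s' \<and> reg s' rD \<le> 2 * m \<and> (\<forall>d \<in> {1..reg s' rD}. mem s' aVis (ddst d) = 0)" for s'
  have "I (sem (Const rD 0) s)" using s by (simp add: I_def)
  then have "run (WHILE (Less rD rMM) (Inc rD ;; Load rY aDst rD ;; Store aVis rY rZero))
      (sem (Const rD 0) s) (8 * m + 1) (\<lambda>s'. I s' \<and> \<not> holds (Less rD rMM) s')"
  proof (rule run_WHILE[where k = 3 and \<mu> = "\<lambda>s. 2 * m - reg s rD"])
    fix s' assume *: "I s'" "holds (Less rD rMM) s'"
    then have s': "static s'" by (simp add: I_def)
    have lt: "reg s' rD < 2 * m" using * staticD(4)[OF s'] by simp
    have "mem s' aDst (Suc (reg s' rD)) = ddst (Suc (reg s' rD))"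
      using lt by (intro staticD[OF s']) auto
    then show "run (Inc rD ;; Load rY aDst rD ;; Store aVis rY rZero) s' 3
        (\<lambda>s''. I s'' \<and> 2 * m - reg s'' rD < 2 * m - reg s' rD)"
      using * lt by (intro run_loop_free) (auto simp: I_def staticD(3)[OF s'] le_Suc_eq)
  qed auto
  then show ?thesis unfolding clear_visited_def
  proof (intro run_sem_Seq[OF run_weaken])
    fix s' assume *: "I s' \<and> \<not> holds (Less rD rMM) s'"
    then have "static s'" by (simp add: I_def)
    with * show "\<forall>d \<in> darts. mem s' aVis (ddst d) = 0" by (auto simp: staticD(4) I_def)
  qed auto
qed

text \<open>
  The first \<open>N\<close> entries of the queue are the visited vertices; the parent dart of each of them
  starts at an earlier one.
\<close>

definition search_tree :: "nat \<Rightarrow> (nat \<Rightarrow> nat) \<Rightarrow> (nat \<Rightarrow> nat) \<Rightarrow> (nat \<Rightarrow> nat) \<Rightarrow> nat \<Rightarrow> bool" where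
  "search_tree v cap vis q N \<longleftrightarrow> 0 < N \<and> q 0 = r \<and> inj_on q {..<N} \<and> v \<notin> q ` {..<N} \<and> vis v \<noteq> 0 \<and>
     (\<forall>i \<in> {0<..<N}. vis (q i) \<in> darts \<and> ddst (vis (q i)) = q i \<and> cap (vis (q i)) \<noteq> 0
        \<and> dsrc (vis (q i)) \<in> q ` {..<i}) \<and>
     (\<forall>d \<in> darts. ddst d \<noteq> v \<longrightarrow> (vis (ddst d) \<noteq> 0 \<longleftrightarrow> ddst d \<in> q ` {..<N}))"

text \<open>
  \<open>h\<close> is the position in the queue and \<open>d\<close> the current dart of the list of \<open>q h\<close>. Lists are
  decreasing, so the darts larger than \<open>d\<close> have been dealt with.
\<close>

definition scanned :: "(nat \<Rightarrow> nat) \<Rightarrow> nat \<Rightarrow> nat \<Rightarrow> nat set" where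
  "scanned q h d = {d' \<in> darts. dsrc d' \<in> q ` {..<h} \<or> dsrc d' = q h \<and> d < d'}"

text \<open>Once \<open>h = N\<close>, the value \<open>d\<close> was fetched from beyond the queue
  and is meaningless, hence the guard \<open>h < N\<close>. The last clause is the one that survives
  termination.\<close>

definition search_inv where
  "search_inv v cap vis q N h d \<longleftrightarrow> search_tree v cap vis q N \<and> h \<le> N \<and>
     (h < N \<longrightarrow> (d = 0 \<or> d \<in> darts \<and> dsrc d = q h) \<and>
        (\<forall>d' \<in> scanned q h d. cap d' \<noteq> 0 \<longrightarrow> vis (ddst d') \<noteq> 0)) \<and>
     (\<forall>d' \<in> darts. dsrc d' \<in> q ` {..<h} \<longrightarrow> cap d' \<noteq> 0 \<longrightarrow> vis (ddst d') \<noteq> 0)"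

text \<open>Apart from \<open>r\<close>, every queued vertex is the destination of a dart; this
  bounds the queue in terms of \<open>m\<close>.\<close>

lemma search_tree_size:
  assumes "search_tree v cap vis q N" shows "N \<le> Suc (2 * m)"
proof -
  have "q i = r \<or> q i \<in> ddst ` darts" if "i < N" for i
  proof (cases "i = 0")
    case False
    then have "vis (q i) \<in> darts" "q i = ddst (vis (q i))" using assms that by (simp_all add: search_tree_def)
    then show ?thesis by blast
  qed (use assms in \<open>simp add: search_tree_def\<close>)
  then have "q ` {..<N} \<subseteq> insert r (ddst ` darts)" by auto
  then have "card (q ` {..<N}) \<le> card (insert r (ddst ` darts))" by (intro card_mono) auto
  also have "\<dots> \<le> Suc (card (ddst ` darts))" by (rule card_insert_le_m1) auto
  also have "\<dots> \<le> Suc (card darts)" using card_image_le[of darts ddst] by simp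
  finally show ?thesis using assms by (simp add: card_image search_tree_def)
qed

lemma search_discover:
  assumes inv: "search_inv v cap vis q N h d" and "h < N" "0 < d" "cap d \<noteq> 0" and new: "vis (ddst d) = 0"
  shows "search_inv v cap (vis(ddst d := d)) (q(N := ddst d)) (Suc N) h d"
proof -
  let ?y = "ddst d" let ?vis = "vis(?y := d)" and ?q = "q(N := ?y)"
  have tree: "search_tree v cap vis q N" and d: "d \<in> darts" "dsrc d = q h"
    using assms by (auto simp: search_inv_def)
  have yv: "?y \<noteq> v" and y_new: "?y \<notin> q ` {..<N}"
    using tree new d by (auto simp: search_tree_def)
  have img: "?q ` {..<i} = q ` {..<i}" if "i \<le> N" for i using that by (auto simp: image_def)
  have img_Suc: "?q ` {..<Suc N} = insert ?y (q ` {..<N})"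
    unfolding lessThan_Suc image_insert img[OF order_refl] by simp
  have "inj_on ?q {..<N}" using tree y_new by (intro inj_on_fun_updI) (simp_all add: search_tree_def)
  then have "inj_on ?q {..<Suc N}"
    using y_new img[of N] by (simp add: lessThan_Suc del: fun_upd_image)
  moreover have "?vis (?q i) \<in> darts \<and> ddst (?vis (?q i)) = ?q i \<and> cap (?vis (?q i)) \<noteq> 0
        \<and> dsrc (?vis (?q i)) \<in> ?q ` {..<i}" if "i \<in> {0<..<Suc N}" for i
  proof (cases "i = N")
    case True
    then show ?thesis using d assms img[of N] by auto
  next
    case False
    then have i: "i \<in> {0<..<N}" using that by auto
    then have "q i \<noteq> ?y" using y_new by force
    then show ?thesis using tree i False img[of i] by (auto simp: search_tree_def)
  qed
  moreover have "?vis (ddst d') \<noteq> 0 \<longleftrightarrow> ddst d' \<in> ?q ` {..<Suc N}" if "d' \<in> darts" "ddst d' \<noteq> v" for d'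
    using tree that assms(3) unfolding img_Suc by (auto simp: search_tree_def)
  ultimately have "search_tree v cap ?vis ?q (Suc N)"
    using tree yv img_Suc by (auto simp: search_tree_def)
  moreover have "?q h = q h" "?q ` {..<h} = q ` {..<h}" using assms(2) img[of h] by auto
  ultimately show ?thesis
    using inv assms(2,3) by (auto simp: search_inv_def scanned_def)
qed

text \<open>No dart of \<open>q h\<close> lies strictly between \<open>d'\<close> and
  \<open>d\<close>, so only \<open>d\<close> itself has to be checked. It is newly scanned because
  \<open>q\<close> is injective and its source occurs at no earlier position.\<close>

lemma search_advance:
  assumes inv: "search_inv v cap vis q N h d" and "h < N" "0 < d" "cap d \<noteq> 0 \<Longrightarrow> vis (ddst d) \<noteq> 0"
    and d': "last_dart (dsrc d) (d - 1) d'"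
  shows "search_inv v cap vis q N h d'" "card (darts - scanned q h d') < card (darts - scanned q h d)"
proof -
  have d: "d \<in> darts" "dsrc d = q h" using assms by (auto simp: search_inv_def)
  have "d' = 0 \<or> d' \<in> darts \<and> dsrc d' = q h" "d' < d" using d' d by (auto simp: last_dart_def)
  moreover have sub: "dsrc x = q h \<Longrightarrow> d' < x \<Longrightarrow> x = d \<or> d < x" for x
    using d' d by (force simp: last_dart_def)
  moreover have "vis (ddst x) \<noteq> 0" if "x \<in> darts" "dsrc x = q h" "d' < x" "cap x \<noteq> 0" for x
    using sub[OF that(2,3)] inv assms(2,4) that by (auto simp: search_inv_def scanned_def)
  ultimately show "search_inv v cap vis q N h d'"
    using inv assms(2) by (auto simp: search_inv_def scanned_def)
  have "q h \<notin> q ` {..<h}"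
    using inv assms(2) inj_on_image_mem_iff[of q "{..<N}" h "{..<h}"]
    by (simp add: search_inv_def search_tree_def subset_eq)
  then have "d \<notin> scanned q h d" using d by (simp add: scanned_def)
  moreover have "insert d (scanned q h d) \<subseteq> scanned q h d'"
    using d \<open>d' < d\<close> by (auto simp: scanned_def)
  ultimately have "darts - scanned q h d' \<subset> darts - scanned q h d" using d by auto
  then show "card (darts - scanned q h d') < card (darts - scanned q h d)" by (intro psubset_card_mono) auto
qed

text \<open>Here no dart need be newly scanned; the progress of such a step is the increase of
  \<open>h\<close>.\<close>

lemma search_next_vertex:
  assumes inv: "search_inv v cap vis q N h 0" and "h < N"
    and d': "last_dart (q (Suc h)) (2 * m) d'"
  shows "search_inv v cap vis q N (Suc h) d'"
    "card (darts - scanned q (Suc h) d') \<le> card (darts - scanned q h 0)"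
proof -
  have img: "q ` {..<Suc h} = insert (q h) (q ` {..<h})" by (auto simp: lessThan_Suc)
  have fin: "cap x \<noteq> 0 \<Longrightarrow> vis (ddst x) \<noteq> 0" if "x \<in> darts" "dsrc x \<in> q ` {..<Suc h}" for x
    using inv assms(2) that unfolding img by (auto simp: search_inv_def scanned_def)
  have "dsrc x \<noteq> q (Suc h)" if "x \<in> darts" "d' < x" for x
    using d' that by (auto simp: last_dart_def)
  then show "search_inv v cap vis q N (Suc h) d'"
    using inv assms(2) fin d' by (auto simp: search_inv_def scanned_def last_dart_def)
  show "card (darts - scanned q (Suc h) d') \<le> card (darts - scanned q h 0)"
    by (intro card_mono) (auto simp: scanned_def img)
qed

lemma search_step_sem:
  assumes s: "static s" and inv: "search_inv v (mem s aCap) (mem s aVis) (mem s aQueue) (reg s rQt) (reg s rQh) (reg s rD)"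
    and lt: "reg s rQh < reg s rQt"
  defines "s' \<equiv> sem search_step s"
  shows "search_inv v (mem s' aCap) (mem s' aVis) (mem s' aQueue) (reg s' rQt) (reg s' rQh) (reg s' rD)"
    and "card (darts - scanned (mem s' aQueue) (reg s' rQh) (reg s' rD)) + (Suc (2 * m) - reg s' rQh)
       < card (darts - scanned (mem s aQueue) (reg s rQh) (reg s rD)) + (Suc (2 * m) - reg s rQh)"
proof -
  let ?cap = "mem s aCap" and ?vis = "mem s aVis" and ?q = "mem s aQueue"
  let ?N = "reg s rQt" and ?h = "reg s rQh" and ?d = "reg s rD"
  \<comment> \<open>Ensures that the truncated difference \<open>Suc (2 * m) - h\<close> really
    drops when \<open>h < N\<close> is incremented.\<close>
  have N: "?N \<le> Suc (2 * m)" using inv search_tree_size by (auto simp: search_inv_def)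
  have *: "search_inv v (mem s' aCap) (mem s' aVis) (mem s' aQueue) (reg s' rQt) (reg s' rQh) (reg s' rD) \<and>
    card (darts - scanned (mem s' aQueue) (reg s' rQh) (reg s' rD)) + (Suc (2 * m) - reg s' rQh)
       < card (darts - scanned ?q ?h ?d) + (Suc (2 * m) - ?h)"
  proof (cases "0 < ?d")
    case True
    then have d: "?d \<in> darts" using inv lt by (auto simp: search_inv_def)
    note [simp] = staticD(3)[OF s] staticD(10)[OF s d]
    note nxt = staticD(13)[OF s d]
    show ?thesis
    proof (cases "?cap ?d \<noteq> 0 \<and> ?vis (ddst ?d) = 0")
      case new: True
      let ?q' = "?q(?N := ddst ?d)"
      note disc = search_discover[OF inv lt True, OF conjunct1[OF new] conjunct2[OF new]]
      have eq: "scanned ?q' ?h x = scanned ?q ?h x" for x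
        using lt by (auto simp: scanned_def image_def)
      note adv = search_advance[OF disc _ True _ nxt]
      show ?thesis using adv lt True new unfolding s'_def search_step_def
        by (auto simp: eq)
    next
      case False
      then have "?cap ?d \<noteq> 0 \<Longrightarrow> ?vis (ddst ?d) \<noteq> 0" by auto
      note adv = search_advance[OF inv lt True this nxt]
      show ?thesis using adv lt True False unfolding s'_def search_step_def by auto
    qed
  next
    case False
    then have d: "?d = 0" by simp
    note nv = search_next_vertex[OF inv[unfolded d] lt staticD(12)[OF s]]
    show ?thesis using nv lt d N unfolding s'_def search_step_def
      by (auto simp: staticD(3)[OF s])
  qed
  then show "search_inv v (mem s' aCap) (mem s' aVis) (mem s' aQueue) (reg s' rQt) (reg s' rQh) (reg s' rD)"
    "card (darts - scanned (mem s' aQueue) (reg s' rQh) (reg s' rD)) + (Suc (2 * m) - reg s' rQh)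
       < card (darts - scanned (mem s aQueue) (reg s rQh) (reg s rD)) + (Suc (2 * m) - reg s rQh)"
    by blast+
qed

definition searched :: "nat \<Rightarrow> state \<Rightarrow> bool" where
  "searched v s \<longleftrightarrow> search_tree v (mem s aCap) (mem s aVis) (mem s aQueue) (reg s rQt) \<and>
     (\<forall>d \<in> darts. dsrc d \<in> mem s aQueue ` {..<reg s rQt} \<longrightarrow> mem s aCap d \<noteq> 0 \<longrightarrow> mem s aVis (ddst d) \<noteq> 0)"

lemma run_search:
  assumes s: "static s" and vr: "reg s rV \<noteq> r"
  shows "run search s (60 * m + 30) (searched (reg s rV))"
  unfolding search_def
proof (rule run_Seq[OF run_clear_visited[OF s] run_sem_Seq])
  fix s1 assume u: "unchanged clear_visited s s1" and vis: "\<forall>d\<in>darts. mem s1 aVis (ddst d) = 0"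
  have s1: "static s1" using s u by (rule static_unchanged) (auto simp: clear_visited_def)
  have v1: "reg s1 rV = reg s rV" using u by (simp add: unchanged_def clear_visited_def)
  let ?v = "reg s rV" and ?s2 = "sem init_queue s1"
  define I where "I s' \<longleftrightarrow> static s' \<and>
    search_inv ?v (mem s' aCap) (mem s' aVis) (mem s' aQueue) (reg s' rQt) (reg s' rQh) (reg s' rD)" for s'
  let ?\<mu> = "\<lambda>s. card (darts - scanned (mem s aQueue) (reg s rQh) (reg s rD)) + (Suc (2 * m) - reg s rQh)"
  note [simp] = staticD(2,5)[OF s1] v1
  have "I ?s2"
    using s1 vr vis staticD(12)[OF s1, of r]
    by (auto simp: I_def init_queue_def search_inv_def search_tree_def scanned_def last_dart_def inj_on_def lessThan_Suc)
  then have "run (WHILE (Less rQh rQt) search_step) ?s2 (52 * m + 14) (\<lambda>s'. I s' \<and> \<not> holds (Less rQh rQt) s')"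
  proof (rule run_WHILE[where k = 12 and \<mu> = ?\<mu>])
    fix s' assume *: "I s'" "holds (Less rQh rQt) s'"
    then have s': "static s'"
      and inv: "search_inv ?v (mem s' aCap) (mem s' aVis) (mem s' aQueue) (reg s' rQt) (reg s' rQh) (reg s' rD)"
      by (auto simp: I_def)
    have "reg s' rQh < reg s' rQt" using * by simp
    note step = search_step_sem[OF s' inv this]
    show "run search_step s' 12 (\<lambda>s''. I s'' \<and> ?\<mu> s'' < ?\<mu> s')"
    proof (rule run_loop_free)
      have "static (sem search_step s')" using s' by (simp add: search_step_def)
      then show "I (sem search_step s') \<and> ?\<mu> (sem search_step s') < ?\<mu> s'"
        using step by (simp add: I_def)
    qed (simp_all add: search_step_def)
  next
    \<comment> \<open>At most \<open>2 * m\<close> unscanned darts and \<open>2 * m + 1\<close>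
      queue positions; each unit costs at most twelve steps and a test, whence
      \<open>52 * m + 14\<close>.\<close>
    have "card (darts - scanned (mem ?s2 aQueue) (reg ?s2 rQh) (reg ?s2 rD)) \<le> card darts"
      by (intro card_mono) auto
    then have "?\<mu> ?s2 \<le> 4 * m + 1" by simp
    then have "?\<mu> ?s2 * 13 \<le> (4 * m + 1) * 13" by (rule mult_right_mono) simp
    then show "Suc (?\<mu> ?s2 * Suc 12) \<le> 52 * m + 14" by simp
  qed
  then show "run (WHILE (Less rQh rQt) search_step) ?s2 (52 * m + 14) (searched ?v)"
    by (rule run_weaken) (auto simp: I_def search_inv_def searched_def)
qed (auto simp: init_queue_def)

subsection \<open>Augmenting the flow\<close>

definition used :: "(nat \<Rightarrow> nat) \<Rightarrow> nat set" where
  "used cap = {a. a < m \<and> cap (Suc a) = 0}"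

definition complementary :: "(nat \<Rightarrow> nat) \<Rightarrow> bool" where
  "complementary cap \<longleftrightarrow> (\<forall>a<m. cap (Suc a) = 0 \<longleftrightarrow> cap (Suc (m + a)) \<noteq> 0)"

text \<open>Integer-valued because a vertex has excess \<open>-1\<close> in the middle of an
  augmentation.\<close>

definition excess :: "nat set \<Rightarrow> nat \<Rightarrow> int" where
  "excess f u = int (card (into f u)) - int (card (outof f u))"

definition flip_cap :: "(nat \<Rightarrow> nat) \<Rightarrow> nat \<Rightarrow> nat \<Rightarrow> nat" where
  "flip_cap cap d = cap(d := 0, dopp d := 1)"

lemma dart_simps:
  assumes "a < m"
  shows "dsrc (Suc a) = tail G a" "ddst (Suc a) = head G a" "dopp (Suc a) = Suc (m + a)"
    "dsrc (Suc (m + a)) = head G a" "ddst (Suc (m + a)) = tail G a" "dopp (Suc (m + a)) = Suc a"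
    "Suc a \<in> darts" "Suc (m + a) \<in> darts"
  using assms by (auto simp: dsrc_def ddst_def dopp_def)

lemma dart_cases:
  assumes "d \<in> darts"
  obtains (fwd) a where "a < m" "d = Suc a" | (bwd) a where "a < m" "d = Suc (m + a)"
proof (cases "d \<le> m")
  case True
  then show ?thesis using assms fwd[of "d - 1"] by auto
next
  case False
  then show ?thesis using assms bwd[of "d - 1 - m"] by auto
qed

lemma used_subset: "used cap \<subseteq> arcs G"
  by (auto simp: used_def arcs_eq)

lemma finite_used [simp]: "finite (used cap)"
  using used_subset finite_arc_subset by blast

lemma complementary_flip:
  assumes "complementary cap" "d \<in> darts"
  shows "complementary (flip_cap cap d)"
  using assms(2)
  by (cases rule: dart_cases) (use assms(1) in \<open>auto simp: complementary_def flip_cap_def dart_simps\<close>)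

lemma flip_cap_other: "cap d' \<noteq> 0 \<Longrightarrow> d' \<noteq> d \<Longrightarrow> flip_cap cap d d' \<noteq> 0"
  by (simp add: flip_cap_def)

lemma used_flip_fwd: "a < m \<Longrightarrow> used (flip_cap cap (Suc a)) = insert a (used cap)"
  by (auto simp: used_def flip_cap_def dart_simps)

lemma used_flip_bwd: "a < m \<Longrightarrow> used (flip_cap cap (Suc (m + a))) = used cap - {a}"
  by (auto simp: used_def flip_cap_def dart_simps)

lemma excess_insert:
  assumes "finite f" "a \<notin> f"
  shows "excess (insert a f) u
    = excess f u + (if head G a = u then 1 else 0) - (if tail G a = u then 1 else 0)"
proof -
  have "into (insert a f) u = (if head G a = u then insert a (into f u) else into f u)"
    "outof (insert a f) u = (if tail G a = u then insert a (outof f u) else outof f u)"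
    by auto
  then show ?thesis using assms by (simp add: excess_def)
qed

text \<open>Adding an arc and removing one look alike on residual darts: one unit moves from source
  to destination.\<close>

lemma excess_flip:
  assumes "complementary cap" "d \<in> darts" "cap d \<noteq> 0"
  shows "excess (used (flip_cap cap d)) u
    = excess (used cap) u + (if ddst d = u then 1 else 0) - (if dsrc d = u then 1 else 0)"
  using assms(2)
proof (cases rule: dart_cases)
  case (fwd a)
  then have "a \<notin> used cap" using assms(3) by (simp add: used_def)
  with fwd show ?thesis by (simp add: used_flip_fwd excess_insert dart_simps)
next
  case (bwd a)
  then have "a \<in> used cap" using assms(1,3) by (simp add: used_def complementary_def)
  then have "insert a (used cap - {a}) = used cap" by blast
  with bwd excess_insert[of "used cap - {a}" a u] show ?thesis
    by (simp add: used_flip_bwd dart_simps)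
qed

text \<open>Keeps the accepted arcs in place while the rest of the path is augmented.\<close>

lemma flip_avoids:
  assumes "d \<in> darts" "dsrc d \<noteq> v" "ddst d \<noteq> v"
  shows "into (used (flip_cap cap d)) v = into (used cap) v"
    "outof (used (flip_cap cap d)) v = outof (used cap) v"
  using assms(1)
  by (cases rule: dart_cases;
      use assms(2,3) in \<open>auto simp: used_flip_fwd used_flip_bwd dart_simps\<close>)+

lemma flow_iff_excess:
  "flow r v (used cap) \<longleftrightarrow> (\<forall>u. u \<noteq> r \<longrightarrow> u \<noteq> v \<longrightarrow> excess (used cap) u = 0)"
  using used_subset by (auto simp: flow_def excess_def)

lemma sem_flip:
  assumes "static s" "reg s rD \<in> darts"
  shows "static (sem flip s)" "mem (sem flip s) aCap = flip_cap (mem s aCap) (reg s rD)"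
    "reg (sem flip s) rX = dsrc (reg s rD)" "reg (sem flip s) rD = mem s aVis (dsrc (reg s rD))"
    "mem (sem flip s) aVis = mem s aVis"
  using assms by (simp_all add: flip_def flip_cap_def staticD(3,5,9,11))

text \<open>The path is traversed backwards from \<open>v\<close>, and each flip passes the deficit
  to the parent. Parents stand earlier in the queue, so the queue position is a termination measure
  and the queue length bounds the walk.\<close>

lemma run_augment:
  assumes s: "static s" and v: "reg s rV = v" "v \<noteq> r"
    and srch: "searched v s" and comp: "complementary (mem s aCap)"
    and fl: "flow r v (used (mem s aCap))" and fo: "outof (used (mem s aCap)) v = {}"
    and e: "reg s rE < m" "head G (reg s rE) = v" "reg s rE \<notin> used (mem s aCap)"
    and vis: "mem s aVis (tail G (reg s rE)) \<noteq> 0"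
  shows "run augment s (12 * m + 20) (\<lambda>s'. static s' \<and> complementary (mem s' aCap) \<and>
     flow r v (used (mem s' aCap)) \<and> outof (used (mem s' aCap)) v = {} \<and>
     into (used (mem s' aCap)) v = insert (reg s rE) (into (used (mem s aCap)) v) \<and>
     mem s' aOut = (mem s aOut)(reg s rE := 1))"
proof -
  let ?e = "reg s rE" and ?q = "mem s aQueue" and ?N = "reg s rQt" and ?vis = "mem s aVis"
  let ?B = "insert ?e (into (used (mem s aCap)) v)"
  have tree: "search_tree v (mem s aCap) ?vis ?q ?N" using srch by (simp add: searched_def)
  then have q0: "?q 0 = r" "0 < ?N" and inj: "inj_on ?q {..<?N}" and vq: "v \<notin> ?q ` {..<?N}"
    by (auto simp: search_tree_def)
  have par: "?vis (?q i) \<in> darts" "ddst (?vis (?q i)) = ?q i" "mem s aCap (?vis (?q i)) \<noteq> 0"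
     "dsrc (?vis (?q i)) \<in> ?q ` {..<i}" if "0 < i" "i < ?N" for i
    using tree that by (auto simp: search_tree_def)
  have qr: "?q i \<noteq> r" if "0 < i" "i < ?N" for i
    using that inj q0 by (metis inj_onD lessThan_iff less_irrefl)
  \<comment> \<open>A loop would find its tail \<open>v\<close> marked although \<open>v\<close> is
    never queued; acyclicity excludes this.\<close>
  have tv: "tail G ?e \<noteq> v" using acyclic_loopfree[OF acyclic, of ?e] e by (auto simp: arcs_eq)
  \<comment> \<open>The flow is conserved except for one missing unit at the current vertex \<open>q i\<close>, and the path from
    there back to \<open>r\<close> is still residual since parents occur earlier in the queue.\<close>
  define I where "I s' \<longleftrightarrow> static s' \<and> mem s' aVis = ?vis(r := 0) \<and> complementary (mem s' aCap) \<and>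
     into (used (mem s' aCap)) v = ?B \<and> outof (used (mem s' aCap)) v = {} \<and>
     mem s' aOut = (mem s aOut)(?e := 1) \<and>
     (\<exists>i<?N. reg s' rX = ?q i \<and> reg s' rD = (?vis(r := 0)) (?q i) \<and>
        (\<forall>k. 0 < k \<longrightarrow> k \<le> i \<longrightarrow> mem s' aCap (?vis (?q k)) \<noteq> 0) \<and>
        (\<forall>u. u \<noteq> r \<longrightarrow> u \<noteq> v \<longrightarrow> excess (used (mem s' aCap)) u = (if u = ?q i then - 1 else 0)))" for s'
  let ?pre = "Store aOut rE rOne ;; Store aVis rRoot rZero ;; Copy rD rE ;; Inc rD"
  let ?s1 = "sem ?pre s" and ?s2 = "sem flip (sem ?pre s)"
  have s1: "static ?s1" "reg ?s1 rD = Suc ?e" "mem ?s1 aVis = ?vis(r := 0)" "mem ?s1 aCap = mem s aCap"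
     "mem ?s1 aOut = (mem s aOut)(?e := 1)" "Suc ?e \<in> darts"
    using s e by (simp_all add: staticD(2,3,5)[OF s])
  note s2 = sem_flip[OF s1(1) s1(6)[folded s1(2)], unfolded s1]
  have cap_e: "mem s aCap (Suc ?e) \<noteq> 0" using e by (simp add: used_def)
  obtain i where i: "i < ?N" "tail G ?e = ?q i"
  proof -
    have "Suc (m + ?e) \<in> darts" "ddst (Suc (m + ?e)) = tail G ?e" using e dart_simps by auto
    then have "tail G ?e \<in> ?q ` {..<?N}" using tree vis tv unfolding search_tree_def by metis
    then show ?thesis using that by auto
  qed
  have "I ?s2"
    unfolding I_def
  proof (intro conjI exI[of _ i] allI impI)
    show "complementary (mem ?s2 aCap)" unfolding s2 by (rule complementary_flip[OF comp s1(6)])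
    show "into (used (mem ?s2 aCap)) v = ?B"
      unfolding s2 used_flip_fwd[OF e(1)] using e by auto
    show "outof (used (mem ?s2 aCap)) v = {}"
      unfolding s2 used_flip_fwd[OF e(1)] using tv fo by auto
    show "mem ?s2 aOut = (mem s aOut)(?e := 1)" using s1(5) by (simp add: flip_def)
    show "mem ?s2 aCap (?vis (?q k)) \<noteq> 0" if "0 < k" "k \<le> i" for k
    proof -
      have "k < ?N" using that i by simp
      \<comment> \<open>The first flipped dart ends at \<open>v\<close> and tree darts end at queued
        vertices, so it is none of them.\<close>
      then have "ddst (?vis (?q k)) \<noteq> v" using par that vq by auto
      then have "?vis (?q k) \<noteq> Suc ?e" using e dart_simps by auto
      then show ?thesis unfolding s2 using par(3)[OF that(1) \<open>k < ?N\<close>] by (rule flip_cap_other[rotated])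
    qed
    show "excess (used (mem ?s2 aCap)) u = (if u = ?q i then - 1 else 0)" if "u \<noteq> r" "u \<noteq> v" for u
      unfolding s2 excess_flip[OF comp s1(6) cap_e]
      using fl that i e(2) by (simp add: flow_iff_excess dart_simps[OF e(1)])
  qed (use s2 i e in \<open>auto simp: dart_simps\<close>)
  then have loop: "run (WHILE (Less rZero rD) flip) ?s2 (12 * m + 7) (\<lambda>s'. I s' \<and> \<not> holds (Less rZero rD) s')"
  proof (rule run_WHILE[where k = 5 and \<mu> = "\<lambda>s'. inv_into {..<?N} ?q (reg s' rX)"])
    fix s' assume *: "I s'" "holds (Less rZero rD) s'"
    then have s': "static s'" by (simp add: I_def)
    obtain i where i: "i < ?N" "reg s' rX = ?q i" "reg s' rD = (?vis(r := 0)) (?q i)"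
        "\<And>k. 0 < k \<Longrightarrow> k \<le> i \<Longrightarrow> mem s' aCap (?vis (?q k)) \<noteq> 0"
        "\<And>u. u \<noteq> r \<Longrightarrow> u \<noteq> v \<Longrightarrow> excess (used (mem s' aCap)) u = (if u = ?q i then - 1 else 0)"
      using *(1) unfolding I_def by auto
    have "reg s' rD \<noteq> 0" using *(2) staticD(3)[OF s'] by simp
    then have "i \<noteq> 0" using i(3) q0 by (cases "i = 0") auto
    then have i0: "0 < i" by simp
    let ?d = "reg s' rD"
    have D: "?d = ?vis (?q i)" using i(3) qr[OF i0 i(1)] by simp
    have d: "?d \<in> darts" "ddst ?d = ?q i" "mem s' aCap ?d \<noteq> 0"
      using par[OF i0 i(1)] i(4)[OF i0] D by auto
    obtain k where k: "k < i" "dsrc ?d = ?q k" using par(4)[OF i0 i(1)] D by auto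
    have nv: "dsrc ?d \<noteq> v" "ddst ?d \<noteq> v" using d k vq i(1) by auto
    have I: "mem s' aVis = ?vis(r := 0)" "complementary (mem s' aCap)"
      "into (used (mem s' aCap)) v = ?B" "outof (used (mem s' aCap)) v = {}"
      "mem s' aOut = (mem s aOut)(?e := 1)" using *(1) by (simp_all add: I_def)
    note f = sem_flip[OF s' d(1)]
    have qk: "?q k' \<noteq> ?q i" if "k' < i" for k' using that inj i(1) by (auto dest: inj_onD)
    show "run flip s' 5 (\<lambda>s''. I s'' \<and> inv_into {..<?N} ?q (reg s'' rX) < inv_into {..<?N} ?q (reg s' rX))"
    proof (rule run_loop_free)
      have "inv_into {..<?N} ?q (?q j) = j" if "j < ?N" for j using inj that by (simp add: inv_into_f_f)
      then have "inv_into {..<?N} ?q (reg (sem flip s') rX) < inv_into {..<?N} ?q (reg s' rX)"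
        unfolding f(3) k i(2) using i(1) k(1) by simp
      moreover have "I (sem flip s')"
        unfolding I_def
      proof (intro conjI exI[of _ k] allI impI)
        show "complementary (mem (sem flip s') aCap)" unfolding f by (rule complementary_flip[OF I(2) d(1)])
        show "into (used (mem (sem flip s') aCap)) v = ?B"
          unfolding f flip_avoids[OF d(1) nv] by (rule I(3))
        show "outof (used (mem (sem flip s') aCap)) v = {}"
          unfolding f flip_avoids[OF d(1) nv] by (rule I(4))
        show "mem (sem flip s') aOut = (mem s aOut)(?e := 1)" using I(5) by (simp add: flip_def)
        show "mem (sem flip s') aCap (?vis (?q k')) \<noteq> 0" if "0 < k'" "k' \<le> k" for k'
        proof -
          have "k' < i" "k' < ?N" using that k i by auto
          \<comment> \<open>Distinct queue entries have distinct parent darts, so the rest of the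
            path stays residual.\<close>
          then have "?vis (?q k') \<noteq> ?d" using par(2)[OF that(1)] d(2) qk[of k'] by metis
          then show ?thesis unfolding f using i(4)[of k'] that k by (intro flip_cap_other) auto
        qed
        show "excess (used (mem (sem flip s') aCap)) u = (if u = ?q k then - 1 else 0)" if "u \<noteq> r" "u \<noteq> v" for u
          unfolding f excess_flip[OF I(2) d(1,3)] i(5)[OF that] d(2) k(2) using qk[OF k(1)] by auto
      qed (use f k i I in auto)
      ultimately show "I (sem flip s') \<and> inv_into {..<?N} ?q (reg (sem flip s') rX) < inv_into {..<?N} ?q (reg s' rX)"
        by blast
    qed (simp_all add: flip_def)
  next
    have "inv_into {..<?N} ?q (reg ?s2 rX) < ?N"
      using i inj s2 by (simp add: inv_into_f_f dart_simps[OF e(1)])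
    also have "?N \<le> Suc (2 * m)" by (rule search_tree_size[OF tree])
    finally show "Suc (inv_into {..<?N} ?q (reg ?s2 rX) * Suc 5) \<le> 12 * m + 7" by simp
  qed
  show ?thesis
    unfolding augment_def
  proof (rule run_sem_Seq[OF run_weaken[OF _ order_refl]])
    show "run (WHILE (Less rZero rD) flip)
      (sem (Store aOut rE rOne ;; Store aVis rRoot rZero ;; Copy rD rE ;; Inc rD ;; flip) s)
      (12 * m + 7) (\<lambda>s'. I s' \<and> \<not> holds (Less rZero rD) s')"
      using loop by simp
    fix s' assume *: "I s' \<and> \<not> holds (Less rZero rD) s'"
    then have s': "static s'" by (simp add: I_def)
    obtain i where i: "i < ?N" "reg s' rD = (?vis(r := 0)) (?q i)"
        "\<And>u. u \<noteq> r \<Longrightarrow> u \<noteq> v \<Longrightarrow> excess (used (mem s' aCap)) u = (if u = ?q i then - 1 else 0)"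
      using * unfolding I_def by auto
    have "reg s' rD = 0" using * staticD(3)[OF s'] by simp
    have "i = 0"
    proof (rule ccontr)
      assume "i \<noteq> 0"
      with par(1)[of i] qr[of i] i \<open>reg s' rD = 0\<close> show False by simp
    qed
    then have "flow r v (used (mem s' aCap))" using i(3) q0 by (simp add: flow_iff_excess)
    with * show "static s' \<and> complementary (mem s' aCap) \<and>
     flow r v (used (mem s' aCap)) \<and> outof (used (mem s' aCap)) v = {} \<and>
     into (used (mem s' aCap)) v = insert (reg s rE) (into (used (mem s aCap)) v) \<and>
     mem s' aOut = (mem s aOut)(reg s rE := 1)" by (simp add: I_def)
  qed (simp_all add: flip_def)
qed

subsection \<open>Greedy choice at one vertex\<close>

definition marked :: "state \<Rightarrow> nat \<Rightarrow> nat \<Rightarrow> nat set" where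
  "marked s a v = {e. e < m \<and> head G e = v \<and> mem s a e \<noteq> 0}"

definition vertex_inv :: "nat \<Rightarrow> state \<Rightarrow> bool" where
  "vertex_inv v s \<longleftrightarrow> static s \<and> reg s rV = v \<and> complementary (mem s aCap) \<and>
     flow r v (used (mem s aCap)) \<and> outof (used (mem s aCap)) v = {} \<and>
     into (used (mem s aCap)) v = marked s aOut v \<and>
     greedy r w v (marked s aDone v) (marked s aOut v)"

lemma in_arcs_eq: "in_arcs G v = {e. e < m \<and> head G e = v}"
  by (auto simp: in_arcs_def arcs_eq)

text \<open>The queued set is closed under residual darts except towards \<open>v\<close>; forward
  darts give the condition on arcs without flow, backward darts the one on arcs with flow.\<close>

lemma search_failed_cut:
  assumes srch: "searched v s" and comp: "complementary (mem s aCap)"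
    and fl: "flow r v (used (mem s aCap))" "outof (used (mem s aCap)) v = {}"
  defines "R \<equiv> mem s aQueue ` {..<reg s rQt}" and "B \<equiv> into (used (mem s aCap)) v"
  shows "r \<in> R" "v \<notin> R" "card (entering (arcs_via v B) (- R)) \<le> card B"
proof -
  have tree: "search_tree v (mem s aCap) (mem s aVis) (mem s aQueue) (reg s rQt)"
    and full: "\<And>d. d \<in> darts \<Longrightarrow> dsrc d \<in> R \<Longrightarrow> mem s aCap d \<noteq> 0 \<Longrightarrow> mem s aVis (ddst d) \<noteq> 0"
    using srch by (auto simp: searched_def R_def)
  show r: "r \<in> R" and v: "v \<notin> R" using tree by (auto simp: search_tree_def R_def)
  have reach: "ddst d \<in> R \<or> ddst d = v" if "d \<in> darts" "dsrc d \<in> R" "mem s aCap d \<noteq> 0" for d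
    using full[OF that] tree that(1) unfolding search_tree_def R_def by blast
  show "card (entering (arcs_via v B) (- R)) \<le> card B"
    unfolding B_def
  proof (rule residual_unreachable_cut[OF fl r v])
    fix a assume a: "a \<in> arcs G" "a \<notin> used (mem s aCap)" "tail G a \<in> R"
    then have "a < m" by (simp add: arcs_eq)
    then show "head G a \<in> R \<or> head G a = v"
      using reach[of "Suc a"] a by (simp add: used_def dart_simps)
  next
    fix a assume a: "a \<in> used (mem s aCap)" "head G a \<in> R"
    then have "a < m" by (simp add: used_def)
    then show "tail G a \<in> R \<or> tail G a = v"
      using reach[of "Suc (m + a)"] a comp by (simp add: used_def dart_simps complementary_def)
  qed
qed

lemma run_try_arc:
  assumes inv: "vertex_inv v s" and v: "v \<noteq> r"
    and e: "reg s rE \<in> in_arcs G v - marked s aDone v"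
    and emin: "\<forall>x \<in> in_arcs G v - marked s aDone v. w (reg s rE) \<le> w x"
  shows "run try_arc s (72 * m + 60) (\<lambda>s'. vertex_inv v s' \<and> reg s' rGo = reg s rGo \<and>
     mem s' aDone = (mem s aDone)(reg s rE := 1) \<and> (\<forall>a. a \<noteq> reg s rE \<longrightarrow> mem s' aOut a = mem s aOut a))"
proof -
  let ?e = "reg s rE" and ?s1 = "sem (Store aDone rE rOne) s"
  let ?Q = "marked s aDone v" and ?B = "marked s aOut v"
  have s: "static s" "reg s rV = v" and comp: "complementary (mem s aCap)"
    and fl: "flow r v (used (mem s aCap))" "outof (used (mem s aCap)) v = {}"
    and B: "into (used (mem s aCap)) v = ?B" and g: "greedy r w v ?Q ?B"
    using inv by (auto simp: vertex_inv_def)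
  have em: "?e < m" "head G ?e = v" "mem s aDone ?e = 0" using e by (auto simp: in_arcs_eq marked_def)
  have eB: "?e \<notin> ?B" using g e by (auto simp: greedy_def)
  then have e_unused: "?e \<notin> used (mem s aCap)" using B em by auto
  have s1: "static ?s1" "reg ?s1 rV = v" "mem ?s1 aDone = (mem s aDone)(?e := 1)"
    using s by (simp_all add: staticD(5))
  have mQ: "marked s' aDone v = insert ?e ?Q" if "mem s' aDone = (mem s aDone)(?e := 1)" for s'
    using that em by (auto simp: marked_def)
  have tv: "tail G ?e \<noteq> v" using acyclic_loopfree[OF acyclic, of ?e] em by (auto simp: arcs_eq)
  have "run search ?s1 (60 * m + 30) (searched (reg ?s1 rV))"
    using s1 v by (intro run_search) auto
  then have srch: "run search ?s1 (60 * m + 30) (searched v)" using s1(2) by simp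
  show ?thesis
    unfolding try_arc_def
  proof (rule run_sem_Seq[OF run_Seq[OF srch run_sem_Seq[OF run_sem_Seq[OF run_IF]]]])
    fix s2 assume u: "unchanged search ?s1 s2" and sd: "searched v s2"
    let ?s3 = "sem (Load rP aVis rX) (sem (Load rX aTail rE) s2)"
    have s2: "static s2" using s1(1) u
      by (rule static_unchanged) (auto simp: search_def clear_visited_def init_queue_def search_step_def)
    have u2: "reg s2 rV = v" "reg s2 rE = ?e" "reg s2 rGo = reg s rGo" "mem s2 aCap = mem s aCap"
       "mem s2 aOut = mem s aOut" "mem s2 aDone = (mem s aDone)(?e := 1)"
      using u s1 by (simp_all add: unchanged_def search_def clear_visited_def init_queue_def search_step_def)
    have u3: "static ?s3" "reg ?s3 rV = v" "reg ?s3 rE = ?e" "reg ?s3 rGo = reg s rGo" "mem ?s3 aCap = mem s aCap"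
       "mem ?s3 aOut = mem s aOut" "mem ?s3 aDone = (mem s aDone)(?e := 1)" "reg ?s3 rZero = 0"
       "reg ?s3 rP = mem s2 aVis (tail G ?e)" "mem ?s3 aVis = mem s2 aVis"
      using s2 u2 em staticD(3,6)[OF s2] by simp_all
    have sd3: "searched v ?s3" using sd by (simp add: searched_def)
    show "run augment ?s3 (12 * m + 20) (\<lambda>s'. vertex_inv v s' \<and> reg s' rGo = reg s rGo \<and>
     mem s' aDone = (mem s aDone)(?e := 1) \<and> (\<forall>a. a \<noteq> ?e \<longrightarrow> mem s' aOut a = mem s aOut a))"
      if "holds (Less rZero rP) ?s3"
    proof -
      have "mem ?s3 aVis (tail G ?e) \<noteq> 0" using that u3 by simp
      then have "run augment ?s3 (12 * m + 20) (\<lambda>s'. static s' \<and> complementary (mem s' aCap) \<and>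
         flow r v (used (mem s' aCap)) \<and> outof (used (mem s' aCap)) v = {} \<and>
         into (used (mem s' aCap)) v = insert (reg ?s3 rE) (into (used (mem ?s3 aCap)) v) \<and>
         mem s' aOut = (mem ?s3 aOut)(reg ?s3 rE := 1))"
        using u3 v sd3 comp fl em e_unused by (intro run_augment) simp_all
      then show ?thesis
      proof (rule run_weaken[OF _ order_refl])
        fix s4 assume u4: "unchanged augment ?s3 s4"
          and "static s4 \<and> complementary (mem s4 aCap) \<and>
         flow r v (used (mem s4 aCap)) \<and> outof (used (mem s4 aCap)) v = {} \<and>
         into (used (mem s4 aCap)) v = insert (reg ?s3 rE) (into (used (mem ?s3 aCap)) v) \<and>
         mem s4 aOut = (mem ?s3 aOut)(reg ?s3 rE := 1)"
        then have p: "static s4" "complementary (mem s4 aCap)" "flow r v (used (mem s4 aCap))"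
          "outof (used (mem s4 aCap)) v = {}" "into (used (mem s4 aCap)) v = insert ?e ?B"
          "mem s4 aOut = (mem s aOut)(?e := 1)"
          unfolding u3 B by blast+
        have k: "mem s4 aDone = (mem s aDone)(?e := 1)" "reg s4 rV = v" "reg s4 rGo = reg s rGo"
          using u4 u3 by (simp_all add: unchanged_def augment_def flip_def)
        have mB: "marked s4 aOut v = insert ?e ?B" using p(6) em by (auto simp: marked_def)
        have "linkable r v (insert ?e ?B)"
          using flow_imp_linkable[OF p(3,4)] unfolding p(5) .
        then have "greedy r w v (insert ?e ?Q) (insert ?e ?B)" using emin by (intro greedy_insert[OF g e]) auto
        then show "vertex_inv v s4 \<and> reg s4 rGo = reg s rGo \<and>
           mem s4 aDone = (mem s aDone)(?e := 1) \<and> (\<forall>a. a \<noteq> ?e \<longrightarrow> mem s4 aOut a = mem s aOut a)"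
          unfolding vertex_inv_def mB mQ[OF k(1)] using p k by simp
      qed
    qed
    show "run SKIP ?s3 (12 * m + 20) (\<lambda>s'. vertex_inv v s' \<and> reg s' rGo = reg s rGo \<and>
     mem s' aDone = (mem s aDone)(?e := 1) \<and> (\<forall>a. a \<noteq> ?e \<longrightarrow> mem s' aOut a = mem s aOut a))"
      if "\<not> holds (Less rZero rP) ?s3"
    proof (rule run_loop_free)
      have unvis: "mem s2 aVis (tail G ?e) = 0" using that u3 by simp
      let ?R = "mem ?s3 aQueue ` {..<reg ?s3 rQt}"
      \<comment> \<open>Marks and queue membership are linked only at destinations of darts; the
        backward dart of \<open>?e\<close> makes its tail one.\<close>
      have "Suc (m + ?e) \<in> darts" "ddst (Suc (m + ?e)) = tail G ?e" using em dart_simps by auto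
      then have "tail G ?e \<notin> ?R"
        using sd3 tv unvis u3(10) unfolding searched_def search_tree_def by metis
      moreover have "r \<in> ?R" "v \<notin> ?R" "card (entering (arcs_via v ?B) (- ?R)) \<le> card ?B"
        using search_failed_cut[OF sd3] comp fl unfolding u3 B by blast+
      ultimately have "greedy r w v (insert ?e ?Q) ?B"
        using emin by (intro greedy_skip[OF g e, of "- ?R"]) auto
      moreover have "marked ?s3 aOut v = ?B" using u3(6) by (simp only: marked_def)
      ultimately show "vertex_inv v (sem SKIP ?s3) \<and> reg (sem SKIP ?s3) rGo = reg s rGo \<and>
          mem (sem SKIP ?s3) aDone = (mem s aDone)(?e := 1) \<and>
          (\<forall>a. a \<noteq> ?e \<longrightarrow> mem (sem SKIP ?s3) aOut a = mem s aOut a)"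
        using u3 comp fl B mQ[OF u3(7)] by (simp add: vertex_inv_def del: sem.simps(2-8))
    qed simp_all
  qed (rule order_refl | simp)+
qed

lemma run_clear_flow:
  assumes s: "static s"
  shows "run clear_flow s (5 * m + 3) (\<lambda>s'. used (mem s' aCap) = {} \<and> complementary (mem s' aCap))"
proof -
  define I where "I s' \<longleftrightarrow> static s' \<and> reg s' rI \<le> m \<and> reg s' rP = m + reg s' rI \<and>
     (\<forall>a<reg s' rI. mem s' aCap (Suc a) = 1 \<and> mem s' aCap (Suc (m + a)) = 0)" for s'
  let ?s = "sem (Copy rP rM) (sem (Const rI 0) s)"
  have "I ?s" using s by (simp add: I_def staticD(1))
  then have "run (WHILE (Less rI rM) (Inc rI ;; Inc rP ;; Store aCap rI rOne ;; Store aCap rP rZero)) ?s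
      (5 * m + 1) (\<lambda>s'. I s' \<and> \<not> holds (Less rI rM) s')"
  proof (rule run_WHILE[where k = 4 and \<mu> = "\<lambda>s. m - reg s rI"])
    fix s' assume *: "I s'" "holds (Less rI rM) s'"
    then have s': "static s'" by (simp add: I_def)
    have lt: "reg s' rI < m" using * staticD(1)[OF s'] by simp
    show "run (Inc rI ;; Inc rP ;; Store aCap rI rOne ;; Store aCap rP rZero) s' 4
        (\<lambda>s''. I s'' \<and> m - reg s'' rI < m - reg s' rI)"
      using * lt by (intro run_loop_free) (auto simp: I_def staticD(3,5)[OF s'] less_Suc_eq)
  qed auto
  then show ?thesis unfolding clear_flow_def
  proof (intro run_sem_Seq[OF run_sem_Seq[OF run_weaken]])
    fix s' assume *: "I s' \<and> \<not> holds (Less rI rM) s'"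
    then have "static s'" by (simp add: I_def)
    with * have "reg s' rI = m" by (simp add: I_def staticD(1))
    with * show "used (mem s' aCap) = {} \<and> complementary (mem s' aCap)"
      by (auto simp: I_def used_def complementary_def)
  qed auto
qed

lemma run_process_vertex:
  assumes s: "static s" and v: "reg s rV = v" "v \<noteq> r" "marked s aDone v = {}" "marked s aOut v = {}"
  shows "run process_vertex s ((card (in_arcs G v) + 2) * (100 * m + 100)) (\<lambda>s'. static s' \<and>
     marked s' aDone v = in_arcs G v \<and> optimal_basis r w v (marked s' aOut v) \<and>
     (\<forall>a. a \<notin> in_arcs G v \<longrightarrow> mem s' aDone a = mem s aDone a \<and> mem s' aOut a = mem s aOut a))"
  unfolding process_vertex_def
proof (rule run_Seq[OF run_clear_flow[OF s] run_sem_Seq])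
  fix s1 assume u: "unchanged clear_flow s s1" and cap: "used (mem s1 aCap) = {} \<and> complementary (mem s1 aCap)"
  have s1: "static s1" using s u by (rule static_unchanged) (auto simp: clear_flow_def)
  have u1: "reg s1 rV = v" "mem s1 aDone = mem s aDone" "mem s1 aOut = mem s aOut"
    using u v by (simp_all add: unchanged_def clear_flow_def)
  define I where "I s' \<longleftrightarrow> vertex_inv v s' \<and> (reg s' rGo = 0 \<longrightarrow> marked s' aDone v = in_arcs G v) \<and>
     (\<forall>a. a \<notin> in_arcs G v \<longrightarrow> mem s' aDone a = mem s aDone a \<and> mem s' aOut a = mem s aOut a)" for s'
  let ?left = "\<lambda>s'. in_arcs G v - marked s' aDone v"
  \<comment> \<open>The \<open>Suc\<close> accounts for the last round, in which
    \<open>select\<close> finds nothing and leaves \<open>rGo\<close> at 0.\<close>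
  let ?\<mu> = "\<lambda>s'. if reg s' rGo = 0 then 0 else Suc (card (?left s'))"
  let ?s2 = "sem (Const rGo 1) s1"
  have "marked ?s2 aOut v = {}" "marked ?s2 aDone v = {}"
    using v u1 by (simp_all add: marked_def)
  then have "I ?s2"
    using s1 u1 cap v greedy_empty[of r v w] by (simp add: I_def vertex_inv_def flow_def)
  then have "run (WHILE (Less rZero rGo) (select ;; IF (Less rZero rGo) try_arc SKIP)) ?s2
     ((card (in_arcs G v) + 1) * (83 * m + 67) + 1) (\<lambda>s'. I s' \<and> \<not> holds (Less rZero rGo) s')"
  proof (rule run_WHILE[where k = "83 * m + 66" and \<mu> = ?\<mu>])
    fix s' assume *: "I s'" "holds (Less rZero rGo) s'"
    then have inv: "vertex_inv v s'" by (simp add: I_def)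
    then have s': "static s'" "reg s' rV = v" by (simp_all add: vertex_inv_def)
    have go: "reg s' rGo \<noteq> 0" using * staticD(3)[OF s'(1)] by simp
    have "{a. a < m \<and> head G a = reg s' rV \<and> mem s' aDone a = 0} = ?left s'"
      using s'(2) by (auto simp: in_arcs_eq marked_def)
    note sel = run_select[OF s'(1), unfolded this]
    show "run (select ;; IF (Less rZero rGo) try_arc SKIP) s' (83 * m + 66) (\<lambda>s''. I s'' \<and> ?\<mu> s'' < ?\<mu> s')"
    proof (rule run_Seq[OF sel run_IF])
      fix s3 assume u3: "unchanged select s' s3"
        and sel3: "if reg s3 rGo = 0 then ?left s' = {}
            else reg s3 rE \<in> ?left s' \<and> (\<forall>a \<in> ?left s'. w (reg s3 rE) \<le> w a)"
      have s3: "static s3" using s'(1) u3 by (rule static_unchanged) (auto simp: select_def select_step_def)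
      have m3: "mem s3 a = mem s' a" for a using u3 by (simp add: unchanged_def select_def select_step_def)
      have "reg s3 rV = reg s' rV" using u3 by (simp add: unchanged_def select_def select_step_def)
      then have inv3: "vertex_inv v s3" using inv s3 by (simp add: vertex_inv_def m3 marked_def)
      have mk: "marked s3 a v = marked s' a v" for a by (simp add: marked_def m3)
      have go3: "holds (Less rZero rGo) s3 \<longleftrightarrow> reg s3 rGo \<noteq> 0" by (simp add: staticD(3)[OF s3])
      show "run try_arc s3 (72 * m + 60) (\<lambda>s''. I s'' \<and> ?\<mu> s'' < ?\<mu> s')" if h: "holds (Less rZero rGo) s3"
      proof -
        have e: "reg s3 rE \<in> ?left s'" and emin: "\<forall>a \<in> ?left s'. w (reg s3 rE) \<le> w a"
          using h go3 sel3 by auto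
        from run_try_arc[OF inv3 v(2), unfolded mk, OF e emin]
        show ?thesis
        proof (rule run_weaken[OF _ order_refl])
          fix s4 assume p: "vertex_inv v s4 \<and> reg s4 rGo = reg s3 rGo \<and>
             mem s4 aDone = (mem s3 aDone)(reg s3 rE := 1) \<and> (\<forall>a. a \<noteq> reg s3 rE \<longrightarrow> mem s4 aOut a = mem s3 aOut a)"
          then have "marked s4 aDone v = insert (reg s3 rE) (marked s' aDone v)"
            using e by (auto simp: marked_def m3 in_arcs_eq)
          then have "?left s4 \<subset> ?left s'" using e by auto
          then have "card (?left s4) < card (?left s')" by (intro psubset_card_mono) (auto simp: in_arcs_eq)
          moreover have "\<forall>a. a \<notin> in_arcs G v \<longrightarrow> mem s4 aDone a = mem s aDone a \<and> mem s4 aOut a = mem s aOut a"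
            using p e *(1) by (auto simp: I_def m3)
          ultimately show "I s4 \<and> ?\<mu> s4 < ?\<mu> s'" using p h go3 go by (simp add: I_def)
        qed
      qed
      show "run SKIP s3 (72 * m + 60) (\<lambda>s''. I s'' \<and> ?\<mu> s'' < ?\<mu> s')" if h: "\<not> holds (Less rZero rGo) s3"
      proof (rule run_loop_free)
        have go0: "reg s3 rGo = 0" using h go3 by simp
        then have "in_arcs G v \<subseteq> marked s' aDone v" using sel3 by auto
        then have "marked s' aDone v = in_arcs G v" by (auto simp: marked_def in_arcs_eq)
        then show "I (sem SKIP s3) \<and> ?\<mu> (sem SKIP s3) < ?\<mu> s'"
          using inv3 *(1) go go0 by (simp add: I_def mk m3)
      qed simp_all
    qed simp
  next
    have "card (?left ?s2) \<le> card (in_arcs G v)" by (intro card_mono) (auto simp: in_arcs_eq)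
    then have "Suc (card (?left ?s2)) * (83 * m + 67) \<le> (card (in_arcs G v) + 1) * (83 * m + 67)"
      by (intro mult_right_mono) auto
    moreover have "?\<mu> ?s2 * Suc (83 * m + 66) = Suc (card (?left ?s2)) * (83 * m + 67)" by simp
    ultimately show "Suc (?\<mu> ?s2 * Suc (83 * m + 66)) \<le> (card (in_arcs G v) + 1) * (83 * m + 67) + 1"
      by linarith
  qed
  then show "run (WHILE (Less rZero rGo) (select ;; IF (Less rZero rGo) try_arc SKIP)) ?s2
     ((card (in_arcs G v) + 1) * (83 * m + 67) + 1) (\<lambda>s'. static s' \<and>
     marked s' aDone v = in_arcs G v \<and> optimal_basis r w v (marked s' aOut v) \<and>
     (\<forall>a. a \<notin> in_arcs G v \<longrightarrow> mem s' aDone a = mem s aDone a \<and> mem s' aOut a = mem s aOut a))"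
  proof (rule run_weaken[OF _ order_refl])
    fix s' assume *: "I s' \<and> \<not> holds (Less rZero rGo) s'"
    then have s': "static s'" by (simp add: I_def vertex_inv_def)
    with * have all: "marked s' aDone v = in_arcs G v" by (simp add: I_def staticD(3)[OF s'])
    with * have "greedy r w v (in_arcs G v) (marked s' aOut v)" by (simp add: I_def vertex_inv_def)
    then have "optimal_basis r w v (marked s' aOut v)" by (rule greedy_complete)
    then show "static s' \<and>
     marked s' aDone v = in_arcs G v \<and> optimal_basis r w v (marked s' aOut v) \<and>
     (\<forall>a. a \<notin> in_arcs G v \<longrightarrow> mem s' aDone a = mem s aDone a \<and> mem s' aOut a = mem s aOut a)"
      using * s' all by (simp add: I_def)
  qed
next
  have "(card (in_arcs G v) + 1) * (83 * m + 67) \<le> (card (in_arcs G v) + 1) * (100 * m + 100)"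
    by (intro mult_left_mono) auto
  moreover have "(card (in_arcs G v) + 2) * (100 * m + 100)
      = (card (in_arcs G v) + 1) * (100 * m + 100) + (100 * m + 100)" by (simp add: algebra_simps)
  ultimately show "5 * m + 3 + (1 + ((card (in_arcs G v) + 1) * (83 * m + 67) + 1))
     \<le> (card (in_arcs G v) + 2) * (100 * m + 100)" by linarith
qed auto

subsection \<open>All vertices\<close>

definition vertex_done :: "state \<Rightarrow> nat \<Rightarrow> bool" where
  "vertex_done s v \<longleftrightarrow> marked s aDone v = in_arcs G v \<and> optimal_basis r w v (marked s aOut v)"

text \<open>Between passes no vertex is half processed, and \<open>r\<close> stays untouched. Cells
  of \<open>aOut\<close> from \<open>m\<close> on are controlled because \<open>output_arcs\<close>
  reads the whole array.\<close>

definition main_inv :: "state \<Rightarrow> bool" where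
  "main_inv s \<longleftrightarrow> static s \<and> reg s rJ \<le> m \<and> (\<forall>a\<ge>m. mem s aOut a = 0) \<and>
     (\<forall>v. marked s aDone v = {} \<and> marked s aOut v = {} \<or> v \<noteq> r \<and> vertex_done s v) \<and>
     (\<forall>a<reg s rJ. head G a \<noteq> r \<longrightarrow> mem s aDone a \<noteq> 0)"

definition unfinished :: "state \<Rightarrow> nat set" where
  "unfinished s = {a. a < m \<and> head G a \<noteq> r \<and> mem s aDone a = 0}"

text \<open>Covers the vertices without incoming arcs, which the program never processes.\<close>

lemma optimal_basis_empty:
  assumes "v \<noteq> r" "in_arcs G v = {}"
  shows "optimal_basis r w v {}"
  using greedy_complete[of r w v "{}"] greedy_empty[OF assms(1)[symmetric], of w] unfolding assms(2) by simp

text \<open>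
  Three units of \<open>100 m + 100\<close> steps per unfinished arc suffice for a vertex of in-degree \<open>d \<ge> 1\<close>, which
  takes \<open>d + 2 \<le> 3 d\<close> of them.
\<close>

lemma main_step:
  assumes inv: "main_inv s" and j: "reg s rJ < m"
  defines "body \<equiv> Load rV aHead rJ ;; Load rP aDone rJ ;;
       IF (Eq rP rZero) (IF (Eq rV rRoot) SKIP process_vertex) SKIP ;; Inc rJ"
    and "\<Phi> \<equiv> \<lambda>s. (300 * m + 300) * card (unfinished s) + 20 * (m - reg s rJ)"
  shows "\<exists>k. run body s k (\<lambda>s'. main_inv s' \<and> \<Phi> s' + k < \<Phi> s)"
proof -
  let ?v = "head G (reg s rJ)"
  let ?s2 = "sem (Load rP aDone rJ) (sem (Load rV aHead rJ) s)"
  have s: "static s" using inv by (simp add: main_inv_def)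
  have s2: "static ?s2" "reg ?s2 rV = ?v" "reg ?s2 rP = mem s aDone (reg s rJ)" "reg ?s2 rJ = reg s rJ"
    "mem ?s2 = mem s" "reg ?s2 rZero = 0" "reg ?s2 rRoot = r"
    using s j by (simp_all add: staticD(2,3,7)[OF s])
  show ?thesis
  proof (cases "mem s aDone (reg s rJ) = 0 \<and> ?v \<noteq> r")
    case skip: False
    have "run body s 6 (\<lambda>s'. s' = set_reg rJ (Suc (reg s rJ)) ?s2)"
      unfolding body_def
    proof (rule run_sem_Seq[OF run_sem_Seq[OF run_Seq[where P = "\<lambda>s'. s' = ?s2"]]])
      show "run (IF (Eq rP rZero) (IF (Eq rV rRoot) SKIP process_vertex) SKIP) ?s2 (Suc (Suc 1)) (\<lambda>s'. s' = ?s2)"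
      proof (rule run_IF)
        show "run (IF (Eq rV rRoot) SKIP process_vertex) ?s2 (Suc 1) (\<lambda>s'. s' = ?s2)" if "holds (Eq rP rZero) ?s2"
        proof (rule run_IF)
          \<comment> \<open>This branch contradicts \<open>skip\<close>, so its bound of one step is
            vacuous.\<close>
          show "run process_vertex ?s2 1 (\<lambda>s'. s' = ?s2)" if "\<not> holds (Eq rV rRoot) ?s2"
            using that \<open>holds (Eq rP rZero) ?s2\<close> s2 skip by simp
        qed (auto intro: run_loop_free)
      qed (auto intro: run_loop_free)
      show "run (Inc rJ) s' 1 (\<lambda>s'. s' = set_reg rJ (Suc (reg s rJ)) ?s2)" if "s' = ?s2" for s'
        using that by (intro run_loop_free) simp_all
    qed (rule order_refl | simp)+
    \<comment> \<open>The six steps of an idle pass are paid by the 20 units released when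
      \<open>rJ\<close> advances.\<close>
    then have "run body s 6 (\<lambda>s'. main_inv s' \<and> \<Phi> s' + 6 < \<Phi> s)"
    proof (rule run_weaken[OF _ order_refl])
      fix s' assume s': "s' = set_reg rJ (Suc (reg s rJ)) ?s2"
      then have st: "static s'" using s2 by simp
      have mem: "mem s' = mem s" and rj: "reg s' rJ = Suc (reg s rJ)" using s' by simp_all
      have "main_inv s'" using inv j skip st
        by (auto simp: main_inv_def mem rj marked_def vertex_done_def less_Suc_eq)
      then show "main_inv s' \<and> \<Phi> s' + 6 < \<Phi> s" using j by (simp add: \<Phi>_def unfinished_def mem rj)
    qed
    then show ?thesis by blast
  next
    case True
    then have v: "?v \<noteq> r" and fresh: "marked s aDone ?v = {}" "marked s aOut ?v = {}"
    proof -
      have "reg s rJ \<in> in_arcs G ?v - marked s aDone ?v" using j True by (simp add: in_arcs_eq marked_def)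
      then have "\<not> vertex_done s ?v" by (auto simp: vertex_done_def)
      then show "?v \<noteq> r" "marked s aDone ?v = {}" "marked s aOut ?v = {}"
        using inv True by (auto simp: main_inv_def)
    qed
    let ?K = "(card (in_arcs G ?v) + 2) * (100 * m + 100)"
    let ?Q = "\<lambda>s'. static s' \<and> marked s' aDone ?v = in_arcs G ?v \<and> optimal_basis r w ?v (marked s' aOut ?v) \<and>
      (\<forall>a. a \<notin> in_arcs G ?v \<longrightarrow> mem s' aDone a = mem s aDone a \<and> mem s' aOut a = mem s aOut a)"
    have pv: "run process_vertex ?s2 ?K ?Q"
      using run_process_vertex[OF s2(1,2) v] fresh by (simp add: marked_def)
    have "run body s (?K + 5) (\<lambda>s'. main_inv s' \<and> \<Phi> s' + (?K + 5) < \<Phi> s)"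
      unfolding body_def
    proof (rule run_sem_Seq[OF run_sem_Seq[OF run_Seq[where P = "\<lambda>s'. ?Q s' \<and> reg s' rJ = reg s rJ"]]])
      have "run (IF (Eq rP rZero) (IF (Eq rV rRoot) SKIP process_vertex) SKIP) ?s2 (Suc (Suc ?K)) ?Q"
        by (intro run_IF) (use True s2 v pv in auto)
      then show "run (IF (Eq rP rZero) (IF (Eq rV rRoot) SKIP process_vertex) SKIP) ?s2 (?K + 2)
          (\<lambda>s'. ?Q s' \<and> reg s' rJ = reg s rJ)"
        by (rule run_weaken)
          (auto simp: unchanged_def process_vertex_def clear_flow_def select_def select_step_def try_arc_def search_def
            clear_visited_def init_queue_def search_step_def augment_def flip_def)
      fix s3 assume p: "?Q s3 \<and> reg s3 rJ = reg s rJ"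
      let ?s4 = "sem (Inc rJ) s3"
      have outside: "mem s3 aDone e = mem s aDone e" "mem s3 aOut e = mem s aOut e"
        if "head G e = u" "u \<noteq> ?v" for e u
      proof -
        have "e \<notin> in_arcs G ?v" using that by (simp add: in_arcs_eq)
        with p show "mem s3 aDone e = mem s aDone e" "mem s3 aOut e = mem s aOut e" by blast+
      qed
      have same: "marked s3 a u = marked s a u" if "u \<noteq> ?v" "a \<in> {aDone, aOut}" for a u
        using that(2) outside[of _ u] that(1) by (auto simp: marked_def)
      have vd: "vertex_done s3 u" if "u \<noteq> ?v" "vertex_done s u" for u
        using that same by (simp add: vertex_done_def)
      have "main_inv ?s4"
        unfolding main_inv_def
      proof (intro conjI allI impI)
        show "static ?s4" using p by simp
        show "reg ?s4 rJ \<le> m" using p j by simp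
        show "mem ?s4 aOut a = 0" if "m \<le> a" for a
          using that p inv by (simp add: in_arcs_eq main_inv_def)
        show "marked ?s4 aDone u = {} \<and> marked ?s4 aOut u = {} \<or> u \<noteq> r \<and> vertex_done ?s4 u" for u
        proof -
          have "marked ?s4 = marked s3" by (simp add: marked_def fun_eq_iff)
          then have "vertex_done ?s4 = vertex_done s3" by (simp add: vertex_done_def fun_eq_iff)
          moreover have "vertex_done s3 ?v" using p by (simp add: vertex_done_def)
          ultimately show ?thesis
            using same[of u] vd[of u] v inv \<open>marked ?s4 = marked s3\<close>
            by (cases "u = ?v") (auto simp: main_inv_def)
        qed
        show "mem ?s4 aDone a \<noteq> 0" if "a < reg ?s4 rJ" "head G a \<noteq> r" for a
        proof (cases "a \<in> in_arcs G ?v")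
          case True
          then have "a \<in> marked s3 aDone ?v" using p by simp
          then show ?thesis by (simp add: marked_def)
        next
          case False
          then have "a < reg s rJ" using that(1) p j by (auto simp: less_Suc_eq in_arcs_eq)
          then show ?thesis using False p inv that(2) by (simp add: main_inv_def)
        qed
      qed
      moreover have "\<Phi> ?s4 + (?K + 5) < \<Phi> s"
      proof -
        have "unfinished s = unfinished ?s4 \<union> in_arcs G ?v" "unfinished ?s4 \<inter> in_arcs G ?v = {}"
        proof -
          have new: "mem s3 aDone a \<noteq> 0" if "a < m" "head G a = ?v" for a
          proof -
            have "a \<in> marked s3 aDone ?v" using that p by (simp add: in_arcs_eq)
            then show ?thesis by (simp add: marked_def)
          qed
          have old: "mem s aDone a = 0 \<longleftrightarrow> mem s3 aDone a = 0 \<or> head G a = ?v" if "a < m" for a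
          proof (cases "head G a = ?v")
            case True
            then show ?thesis using fresh(1) that by (auto simp: marked_def)
          next
            case False
            then show ?thesis using outside(1)[OF refl False] by simp
          qed
          show "unfinished s = unfinished ?s4 \<union> in_arcs G ?v" "unfinished ?s4 \<inter> in_arcs G ?v = {}"
            using v by (auto simp: unfinished_def in_arcs_eq new old)
        qed
        then have c: "card (unfinished s) = card (unfinished ?s4) + card (in_arcs G ?v)"
          by (simp add: card_Un_disjoint unfinished_def finite_in_arcs)
        have "reg s rJ \<in> in_arcs G ?v" using j by (simp add: in_arcs_eq)
        then have "0 < card (in_arcs G ?v)" using finite_in_arcs by (auto simp: card_gt_0_iff)
        then have "?K \<le> (3 * card (in_arcs G ?v)) * (100 * m + 100)" by (intro mult_right_mono) auto
        also have "\<dots> = (300 * m + 300) * card (in_arcs G ?v)" by (simp add: algebra_simps)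
        finally have K: "?K \<le> (300 * m + 300) * card (in_arcs G ?v)" .
        have "(300 * m + 300) * card (unfinished s)
            = (300 * m + 300) * card (unfinished ?s4) + (300 * m + 300) * card (in_arcs G ?v)"
          unfolding c by (rule distrib_left)
        moreover have "20 * (m - reg ?s4 rJ) + 20 = 20 * (m - reg s rJ)" using p j by simp
        ultimately show ?thesis using K unfolding \<Phi>_def by linarith
      qed
      ultimately show "run (Inc rJ) s3 1 (\<lambda>s'. main_inv s' \<and> \<Phi> s' + (?K + 5) < \<Phi> s)"
        by (intro run_loop_free) simp_all
    qed (rule order_refl | simp)+
    then show ?thesis by blast
  qed
qed

lemma run_flame_program:
  "run flame_program (initial_state G r w) (1000 * (m + 1)\<^sup>2) (\<lambda>s. min_weight_maximal_flame G r w (output_arcs s))"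
  unfolding flame_program_def
proof (rule run_Seq[OF run_preprocess[OF refl]])
  fix s assume u: "unchanged preprocess (initial_state G r w) s" and s: "static s"
  have s0: "reg s rJ = 0" "mem s aOut = (\<lambda>_. 0)" "mem s aDone = (\<lambda>_. 0)"
    using u by (simp_all add: unchanged_def preprocess_def make_darts_def link_darts_def initial_state_def)
  let ?body = "Load rV aHead rJ ;; Load rP aDone rJ ;;
       IF (Eq rP rZero) (IF (Eq rV rRoot) SKIP process_vertex) SKIP ;; Inc rJ"
  let ?\<Phi> = "\<lambda>s. (300 * m + 300) * card (unfinished s) + 20 * (m - reg s rJ)"
  have "main_inv s" using s s0 by (simp add: main_inv_def marked_def)
  then have "run (WHILE (Less rJ rM) ?body) s (Suc (?\<Phi> s)) (\<lambda>s'. main_inv s' \<and> \<not> holds (Less rJ rM) s')"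
  proof (rule run_WHILE_potential)
    fix s' assume *: "main_inv s'" "holds (Less rJ rM) s'"
    then have "static s'" by (simp add: main_inv_def)
    with * have "reg s' rJ < m" by (simp add: staticD(1))
    from main_step[OF *(1) this]
    show "\<exists>k. run ?body s' k (\<lambda>s''. main_inv s'' \<and> ?\<Phi> s'' + k < ?\<Phi> s')" .
  qed
  then show "run (WHILE (Less rJ rM) ?body) s (Suc ((300 * m + 300) * m + 20 * m))
      (\<lambda>s. min_weight_maximal_flame G r w (output_arcs s))"
  proof (rule run_weaken)
    have "unfinished s \<subseteq> {..<m}" by (auto simp: unfinished_def)
    then have "card (unfinished s) \<le> m" using card_mono[of "{..<m}" "unfinished s"] by simp
    then have "(300 * m + 300) * card (unfinished s) \<le> (300 * m + 300) * m" by (intro mult_left_mono) auto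
    then show "Suc (?\<Phi> s) \<le> Suc ((300 * m + 300) * m + 20 * m)" using s0(1) by simp
    fix s' assume *: "main_inv s' \<and> \<not> holds (Less rJ rM) s'"
    then have "static s'" by (simp add: main_inv_def)
    with * have j: "reg s' rJ = m" by (simp add: main_inv_def staticD(1))
    have out: "e < m" if "mem s' aOut e \<noteq> 0" for e
      using * that by (metis main_inv_def not_le)
    then have marked: "into (output_arcs s') v = marked s' aOut v" for v
      by (auto simp: output_arcs_def marked_def)
    show "min_weight_maximal_flame G r w (output_arcs s')"
    proof (rule min_weight_maximal_flame_local[OF acyclic _ root nonneg])
      show "output_arcs s' \<subseteq> arcs G"
        using out by (auto simp: output_arcs_def arcs_eq)
      show "into (output_arcs s') r = {}" unfolding marked using * unfolding main_inv_def by blast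
      fix v assume "v \<in> verts G - {r}"
      then have v: "v \<noteq> r" by simp
      show "optimal_basis r w v (into (output_arcs s') v)"
        unfolding marked
      proof (cases "vertex_done s' v")
        case True
        then show "optimal_basis r w v (marked s' aOut v)" by (simp add: vertex_done_def)
      next
        case False
        then have none: "marked s' aDone v = {}" "marked s' aOut v = {}" using * by (auto simp: main_inv_def)
        have "mem s' aDone e \<noteq> 0" if "e < m" "head G e = v" for e
          using * j v that by (simp add: main_inv_def)
        then have "in_arcs G v = {}" using none(1) by (auto simp: marked_def in_arcs_eq)
        then show "optimal_basis r w v (marked s' aOut v)" using none v by (simp add: optimal_basis_empty)
      qed
    qed
  qed
qed (simp add: power2_eq_square algebra_simps)

end

theorem theorem4:
  shows "\<exists>(P :: com) (T :: nat \<Rightarrow> nat).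
    (\<lambda>m. real (T m)) \<in> O(\<lambda>m. real m ^ 2) \<and>
    (\<forall>(D :: (nat, nat) pre_digraph) (n :: nat) (m :: nat) (r :: nat) (w :: nat \<Rightarrow> rat).
       fin_digraph D \<and> verts D = {..<n} \<and> arcs D = {..<m} \<and> r \<in> verts D \<and>
       acyclic_digraph D \<and> (\<forall>e \<in> arcs D. 0 \<le> w e) \<longrightarrow>
       (\<exists>t s. exec P (initial_state D r w) t s \<and> t \<le> T (card (arcs D)) \<and>
              min_weight_maximal_flame D r w (output_arcs s)))"
proof (rule exI[of _ flame_program], rule exI[of _ "\<lambda>m. 1000 * (m + 1)\<^sup>2"], intro conjI allI impI)
  show "(\<lambda>m. real (1000 * (m + 1)\<^sup>2)) \<in> O(\<lambda>m. real m ^ 2)"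
  proof (rule bigoI[of _ 4000])
    show "\<forall>\<^sub>F m in sequentially. norm (real (1000 * (m + 1)\<^sup>2)) \<le> 4000 * norm (real m ^ 2)"
    proof (rule eventually_sequentiallyI[of 1])
      fix m :: nat assume "1 \<le> m"
      then have "(m + 1)\<^sup>2 \<le> (2 * m)\<^sup>2" by (intro power_mono) auto
      then have "1000 * (m + 1)\<^sup>2 \<le> 4000 * m\<^sup>2" by (simp add: power_mult_distrib)
      then have "real (1000 * (m + 1)\<^sup>2) \<le> real (4000 * m\<^sup>2)" by (rule of_nat_mono)
      then show "norm (real (1000 * (m + 1)\<^sup>2)) \<le> 4000 * norm (real m ^ 2)" by simp
    qed
  qed
  fix D :: "(nat, nat) pre_digraph" and n m r :: nat and w :: "nat \<Rightarrow> rat"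
  assume *: "fin_digraph D \<and> verts D = {..<n} \<and> arcs D = {..<m} \<and> r \<in> verts D \<and>
       acyclic_digraph D \<and> (\<forall>e \<in> arcs D. 0 \<le> w e)"
  then interpret fin_digraph D by simp
  interpret flame_input D n m r w using * by unfold_locales auto
  have "card (arcs D) = m" using * by simp
  then show "\<exists>t s. exec flame_program (initial_state D r w) t s \<and> t \<le> 1000 * (card (arcs D) + 1)\<^sup>2 \<and>
              min_weight_maximal_flame D r w (output_arcs s)"
    using run_flame_program by (simp add: run_def)
qed

end
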